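(* Let $(E\to M,[\cdot,\cdot],\langle\cdot,\cdot\rangle,\rho,H)$ be an $H$-twisted Courant algebroid whose bilinear form has split signature. Then every Dirac structure $L\subset E$, with the restricted bracket and anchor $\rho|_L$, is an $H$-twisted Lie algebroid, with twist induced by $\tilde H$. In particular, the twist $\tilde H$ induces a $\mathrm{D}$-closed $L$-three-form with values in $\ker\rho|_L$.
   Context: $H$-twisted Courant algebroids: $E\to M$ is a smooth vector bundle with a symmetric non-degenerate bilinear form $\langle\cdot,\cdot\rangle$ on its fibres; $E^*$ is identified with $E$ via $\langle\cdot,\cdot\rangle$, sections of $\wedge^pE$ are regarded as alternating $p$-forms on $\Gamma(E)$, and $\langle\alpha,\psi_1\wedge\dots\wedge\psi_p\rangle$ denotes evaluation. Given a bundle map $\rho:E\to TM$, $\Omega^p_M(\ker\rho)$ is the space of smooth sections of $\wedge^pE$ in the kernel of $\tilde\rho:\wedge^pE\to TM\otimes\wedge^{p-1}E$, $\tilde\rho(\psi_1\wedge\dots\wedge\psi_p)=\sum_i(-1)^{i-1}\rho(\psi_i)\otimes\psi_1\wedge\dots\hat\psi_i\dots\wedge\psi_p$, with $\Omega^0_M(\ker\rho)=C^\infty(M)$. For $\alpha\in\Omega^p_M(\ker\rho)$, $\mathcal{D}\alpha$ is defined by $$\langle \mathcal{D}\alpha,\psi_0\wedge\dots\wedge\psi_p\rangle=\sum_{i=0}^p(-1)^i\rho(\psi_i)\langle\alpha,\psi_0\wedge\dots\hat\psi_i\dots\wedge\psi_p\rangle+\sum_{i<j}(-1)^{i+j}\langle\alpha,[\psi_i,\psi_j]\wedge\psi_0\wedge\dots\hat\psi_i\dots\hat\psi_j\dots\wedge\psi_p\rangle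 ;$$ in particular $\mathcal{D}f=\rho^*df$. An $H$-twisted Courant algebroid is such an $E\to M$ with an $\mathbb{R}$-bilinear (not necessarily skew-symmetric) bracket $[\cdot,\cdot]$ on $\Gamma(E)$, a vector bundle morphism $\rho:E\to TM$, the form $\langle\cdot,\cdot\rangle$, and $H\in\Omega^4_M(\ker\rho)$ such that for all $\phi,\psi,\psi_1,\psi_2\in\Gamma(E)$, $f\in C^\infty(M)$: (1) $\tilde H(\phi,\psi_1,\psi_2)=[\phi,[\psi_1,\psi_2]]-[[\phi,\psi_1],\psi_2]-[\psi_1,[\phi,\psi_2]]$; (2) $\mathcal{D}H=0$; (3) $[\phi,f\psi]=\rho(\phi)[f]\psi+f[\phi,\psi]$; (4) $[\psi,\psi]=\tfrac12\mathcal{D}\langle\psi,\psi\rangle$; (5) $\rho(\phi)\langle\psi,\psi\rangle=2\langle[\phi,\psi],\psi\rangle$. Here $\tilde H$ is $H$ viewed as a three-form with values in $\ker\rho\subset E$: $\langle\tilde H(\phi,\psi_1,\psi_2),\chi\rangle=H(\phi,\psi_1,\psi_2,\chi)$. Dirac structures: a vector subbundle $L\subset E$ over $M$ is isotropic if $\langle L,L\rangle\equiv0$, and integrable if $[\Gamma(L),\Gamma(L)]\subset\Gamma(L)$. If $\langle\cdot,\cdot\rangle$ has split signature $(n,n)$, a Dirac structure is a maximal (with respect to inclusion) isotropic subbundle that is integrable. $H$-twisted Lie algebroids: an $H$-twisted Lie algebroid is a vector bundle $A\to M$ with a bundle map $\rho:A\to TM$, a section $H_A\in\Omega^3_M(A,\ker\rho)$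 (an alternating $C^\infty(M)$-multilinear three-form on $\Gamma(A)$ with values in $\Gamma(\ker\rho)$, the smooth sections $v$ of $A$ with $\rho(v)=0$), and a skew-symmetric $\mathbb{R}$-bilinear bracket $[\cdot,\cdot]$ on $\Gamma(A)$ such that (a) $[\phi,[\psi_1,\psi_2]]=[[\phi,\psi_1],\psi_2]+[\psi_1,[\phi,\psi_2]]+H_A(\phi,\psi_1,\psi_2)$; (b) $[\phi,f\psi]=\rho(\phi)[f]\psi+f[\phi,\psi]$; (c) $\mathrm{D}H_A=0$, where for $\omega\in\Omega^p_M(A,\ker\rho)$, with the $A$-connection $\nabla_\psi v:=[\psi,v]$ on $\ker\rho$, $$(\mathrm{D}\omega)(\psi_0,\dots,\psi_p)=\sum_{i}(-1)^i\nabla_{\psi_i}\big(\omega(\psi_0,\dots,\hat\psi_i,\dots,\psi_p)\big)+\sum_{i<j}(-1)^{i+j}\omega([\psi_i,\psi_j],\psi_0,\dots,\hat\psi_i,\dots,\hat\psi_j,\dots,\psi_p).$$ "$L$-three-form with values in $\ker\rho|_L$" means an element of $\Omega^3_M(L,\ker\rho|_L)$, and "$\mathrm{D}$-closed" refers to this operator for $A=L$. A hat denotes omission. *)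

theory Defs
  imports "HOL-Analysis.Analysis" "HOL-Library.Function_Algebras"
begin

text \<open>
  Functions into a real vector space form a real vector space. Together with
  \<open>Function_Algebras\<close> this gives meaning to \<open>\<phi> + \<psi>\<close>, \<open>c *\<^sub>R \<psi>\<close> and \<open>0\<close> for sections,
  for tangent vectors (functionals on functions) and for coordinate vectors.
\<close>

instantiation "fun" :: (type, real_vector) real_vector
begin

definition scaleR_fun :: "real \<Rightarrow> ('a \<Rightarrow> 'b) \<Rightarrow> 'a \<Rightarrow> 'b"
  where "scaleR_fun c f = (\<lambda>x. c *\<^sub>R f x)"

instance
  by standard (auto simp: scaleR_fun_def fun_eq_iff scaleR_add_right scaleR_add_left)

end

definition lin_on :: "'a::real_vector set \<Rightarrow> ('a \<Rightarrow> 'b::real_vector) \<Rightarrow> bool"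
  where "lin_on V f \<longleftrightarrow>
    (\<forall>u\<in>V. \<forall>v\<in>V. f (u + v) = f u + f v) \<and> (\<forall>u\<in>V. \<forall>c. f (c *\<^sub>R u) = c *\<^sub>R f u)"

definition omit :: "nat \<Rightarrow> 'a list \<Rightarrow> 'a list"
  where "omit i xs = take i xs @ drop (Suc i) xs"


section \<open>Smooth functions on open subsets of Euclidean space\<close>

text \<open>
  The model space is the library's \<open>Euclidean_space n\<close>, whose points are the maps
  \<open>nat \<Rightarrow> real\<close> vanishing at all indices \<open>i \<ge> n\<close>; the case \<open>n = 0\<close> is included. Its
  topology is the subspace topology of the product topology on \<open>nat \<Rightarrow> real\<close>.
\<close>

definition has_partial :: "nat \<Rightarrow> ((nat \<Rightarrow> real) \<Rightarrow> real) \<Rightarrow> (nat \<Rightarrow> real) \<Rightarrow> bool"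
  where "has_partial i f z \<longleftrightarrow> (\<lambda>t. f (z(i := t))) differentiable (at (z i))"

definition partial :: "nat \<Rightarrow> ((nat \<Rightarrow> real) \<Rightarrow> real) \<Rightarrow> (nat \<Rightarrow> real) \<Rightarrow> real"
  where "partial i f z = deriv (\<lambda>t. f (z(i := t))) (z i)"

text \<open>\<open>S\<close> is meant to be an open subset of \<open>Euclidean_space n\<close>.\<close>

fun Ck_on :: "nat \<Rightarrow> nat \<Rightarrow> (nat \<Rightarrow> real) set \<Rightarrow> ((nat \<Rightarrow> real) \<Rightarrow> real) \<Rightarrow> bool"
  where
    "Ck_on n 0 S f \<longleftrightarrow> continuous_on S f"
  | "Ck_on n (Suc k) S f \<longleftrightarrow>
       continuous_on S f \<and> (\<forall>i<n. (\<forall>z\<in>S. has_partial i f z) \<and> Ck_on n k S (partial i f))"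

definition Cinf_on :: "nat \<Rightarrow> (nat \<Rightarrow> real) set \<Rightarrow> ((nat \<Rightarrow> real) \<Rightarrow> real) \<Rightarrow> bool"
  where "Cinf_on n S f \<longleftrightarrow> (\<forall>k. Ck_on n k S f)"


section \<open>Smooth manifolds\<close>

text \<open>
  The points of the manifold are all elements of the type \<open>'m\<close>, which carries the topology.
  The atlas need not be maximal. A chart \<open>(U, \<phi>)\<close> only matters on its domain \<open>U\<close>.
\<close>

record 'm manifold =
  mdim :: nat
  atlas :: "('m set \<times> ('m \<Rightarrow> nat \<Rightarrow> real)) set"

definition smooth_manifold :: "'m::{t2_space,second_countable_topology} manifold \<Rightarrow> bool"
  where "smooth_manifold M \<longleftrightarrow>
    (\<forall>(U, \<phi>)\<in>atlas M. open U \<and> openin (Euclidean_space (mdim M)) (\<phi> ` U) \<and>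
       homeomorphic_map (top_of_set U) (subtopology (Euclidean_space (mdim M)) (\<phi> ` U)) \<phi>) \<and>
    (\<Union>(U, \<phi>)\<in>atlas M. U) = UNIV \<and>
    (\<forall>(U, \<phi>)\<in>atlas M. \<forall>(V, \<psi>)\<in>atlas M. \<forall>i<mdim M.
       Cinf_on (mdim M) (\<phi> ` (U \<inter> V)) (\<lambda>z. \<psi> (inv_into U \<phi> z) i))"

text \<open>Smoothness of a function on an open set \<open>W\<close>.\<close>

definition smooth_on :: "'m manifold \<Rightarrow> 'm set \<Rightarrow> ('m \<Rightarrow> real) \<Rightarrow> bool"
  where "smooth_on M W f \<longleftrightarrow>
    (\<forall>(U, \<phi>)\<in>atlas M. Cinf_on (mdim M) (\<phi> ` (U \<inter> W)) (\<lambda>z. f (inv_into U \<phi> z)))"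

definition smooth_functions :: "'m manifold \<Rightarrow> ('m \<Rightarrow> real) set"
  where "smooth_functions M = {f. smooth_on M UNIV f}"


section \<open>Vector bundles\<close>

text \<open>
  The fibres are linear subspaces of an ambient real vector space \<open>'v\<close>, which plays no role
  beyond providing their vector space operations; no smoothness refers to it. Every vector
  bundle has this form, with the direct sum of all its fibres as \<open>'v\<close>.
  A local trivialization \<open>(U, \<Phi>)\<close> consists of linear isomorphisms \<open>\<Phi> x\<close> from the fibre over
  \<open>x \<in> U\<close> onto Euclidean space; the smooth structure of the total space is the one determined
  by the trivializations, whose transition functions are required to be smooth.
\<close>

record ('m, 'v) vbundle =
  fibre :: "'m \<Rightarrow> 'v set"
  vrank :: nat
  trivs :: "('m set \<times> ('m \<Rightarrow> 'v \<Rightarrow> nat \<Rightarrow> real)) set"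

definition frame :: "('m, 'v) vbundle \<Rightarrow> ('m \<Rightarrow> 'v \<Rightarrow> nat \<Rightarrow> real) \<Rightarrow> nat \<Rightarrow> 'm \<Rightarrow> 'v"
  where "frame E \<Phi> j x = inv_into (fibre E x) (\<Phi> x) (\<lambda>i. if i = j then 1 else 0)"

definition vector_bundle ::
    "'m::{t2_space,second_countable_topology} manifold \<Rightarrow> ('m, 'v::real_vector) vbundle \<Rightarrow> bool"
  where "vector_bundle M E \<longleftrightarrow>
    (\<forall>x. subspace (fibre E x)) \<and>
    (\<forall>(U, \<Phi>)\<in>trivs E. open U \<and> (\<forall>x\<in>U. lin_on (fibre E x) (\<Phi> x) \<and>
       bij_betw (\<Phi> x) (fibre E x) (topspace (Euclidean_space (vrank E))))) \<and>
    (\<Union>(U, \<Phi>)\<in>trivs E. U) = UNIV \<and>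
    (\<forall>(U, \<Phi>)\<in>trivs E. \<forall>(V, \<Psi>)\<in>trivs E. \<forall>i<vrank E. \<forall>j<vrank E.
       smooth_on M (U \<inter> V) (\<lambda>x. \<Psi> x (frame E \<Phi> j x) i))"

definition sections :: "'m manifold \<Rightarrow> ('m, 'v::real_vector) vbundle \<Rightarrow> ('m \<Rightarrow> 'v) set"
  where "sections M E = {s. (\<forall>x. s x \<in> fibre E x) \<and>
    (\<forall>(U, \<Phi>)\<in>trivs E. \<forall>i<vrank E. smooth_on M U (\<lambda>x. \<Phi> x (s x) i))}"

definition fscale :: "('m \<Rightarrow> real) \<Rightarrow> ('m \<Rightarrow> 'v::real_vector) \<Rightarrow> 'm \<Rightarrow> 'v"
  where "fscale f s = (\<lambda>x. f x *\<^sub>R s x)"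

text \<open>Smooth vector bundle morphisms over the identity of the base.\<close>

definition bundle_map ::
    "'m manifold \<Rightarrow> ('m, 'v::real_vector) vbundle \<Rightarrow> ('m, 'w::real_vector) vbundle \<Rightarrow>
     ('m \<Rightarrow> 'v \<Rightarrow> 'w) \<Rightarrow> bool"
  where "bundle_map M A B F \<longleftrightarrow>
    (\<forall>x. lin_on (fibre A x) (F x) \<and> F x ` fibre A x \<subseteq> fibre B x) \<and>
    (\<forall>(U, \<Phi>)\<in>trivs A. \<forall>(V, \<Psi>)\<in>trivs B. \<forall>i<vrank B. \<forall>j<vrank A.
       smooth_on M (U \<inter> V) (\<lambda>x. \<Psi> x (F x (frame A \<Phi> j x)) i))"

text \<open>
  A subbundle carries its own vector bundle structure, for which the inclusion is a smooth
  bundle map; such a structure on the family of fibres of \<open>L\<close> is unique if it exists.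
\<close>

definition subbundle ::
    "'m::{t2_space,second_countable_topology} manifold \<Rightarrow> ('m, 'v::real_vector) vbundle \<Rightarrow>
     ('m, 'v) vbundle \<Rightarrow> bool"
  where "subbundle M E L \<longleftrightarrow> vector_bundle M L \<and> bundle_map M L E (\<lambda>x e. e)"


section \<open>The tangent bundle\<close>

text \<open>
  Tangent vectors at \<open>x\<close> are the derivations at \<open>x\<close> of the algebra of smooth functions,
  extended by zero to all functions so that equality of tangent vectors is equality of
  functionals.
\<close>

definition tangent_space :: "'m manifold \<Rightarrow> 'm \<Rightarrow> (('m \<Rightarrow> real) \<Rightarrow> real) set"
  where "tangent_space M x = {v. lin_on (smooth_functions M) v \<and>
    (\<forall>f\<in>smooth_functions M. \<forall>g\<in>smooth_functions M. v (f * g) = f x * v g + g x * v f) \<and>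
    (\<forall>f. f \<notin> smooth_functions M \<longrightarrow> v f = 0)}"

text \<open>
  The components of a tangent vector \<open>v\<close> at \<open>x\<close> in a chart \<open>(U, \<phi>)\<close> are the values of \<open>v\<close> on
  the coordinate functions of \<open>\<phi>\<close>. As these are only defined on \<open>U\<close>, \<open>v\<close> is applied to a
  global smooth function that agrees with the coordinate function near \<open>x\<close>; derivations being
  local, the choice does not matter.
\<close>

definition tangent_coord ::
    "'m::topological_space manifold \<Rightarrow> 'm set \<Rightarrow> ('m \<Rightarrow> nat \<Rightarrow> real) \<Rightarrow> 'm \<Rightarrow>
     (('m \<Rightarrow> real) \<Rightarrow> real) \<Rightarrow> nat \<Rightarrow> real"
  where "tangent_coord M U \<phi> x v i =
    v (SOME f. f \<in> smooth_functions M \<and>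
               (\<exists>W. open W \<and> x \<in> W \<and> W \<subseteq> U \<and> (\<forall>y\<in>W. f y = \<phi> y i)))"

definition tangent_bundle ::
    "'m::topological_space manifold \<Rightarrow> ('m, ('m \<Rightarrow> real) \<Rightarrow> real) vbundle"
  where "tangent_bundle M =
    \<lparr>fibre = tangent_space M, vrank = mdim M,
     trivs = (\<lambda>(U, \<phi>). (U, tangent_coord M U \<phi>)) ` atlas M\<rparr>"

text \<open>
  For \<open>\<rho>\<close> a bundle map to the tangent bundle, \<open>\<rho> x e f\<close> is the derivative of the function \<open>f\<close>
  along the tangent vector \<open>\<rho> x e\<close>.
\<close>

type_synonym ('m, 'v) anchor = "'m \<Rightarrow> 'v \<Rightarrow> ('m \<Rightarrow> real) \<Rightarrow> real"

definition act :: "('m, 'v) anchor \<Rightarrow> ('m \<Rightarrow> 'v) \<Rightarrow> ('m \<Rightarrow> real) \<Rightarrow> 'm \<Rightarrow> real"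
  where "act \<rho> \<psi> f = (\<lambda>x. \<rho> x (\<psi> x) f)"


section \<open>Fibre metrics and multivectors\<close>

definition fibre_metric ::
    "'m manifold \<Rightarrow> ('m, 'v::real_vector) vbundle \<Rightarrow> ('m \<Rightarrow> 'v \<Rightarrow> 'v \<Rightarrow> real) \<Rightarrow> bool"
  where "fibre_metric M E g \<longleftrightarrow>
    (\<forall>x. \<forall>u\<in>fibre E x. lin_on (fibre E x) (g x u) \<and>
       (\<forall>v\<in>fibre E x. g x u v = g x v u) \<and>
       ((\<forall>v\<in>fibre E x. g x u v = 0) \<longrightarrow> u = 0)) \<and>
    (\<forall>(U, \<Phi>)\<in>trivs E. \<forall>i<vrank E. \<forall>j<vrank E.
       smooth_on M U (\<lambda>x. g x (frame E \<Phi> i x) (frame E \<Phi> j x)))"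

definition pairing ::
    "('m \<Rightarrow> 'v \<Rightarrow> 'v \<Rightarrow> real) \<Rightarrow> ('m \<Rightarrow> 'v) \<Rightarrow> ('m \<Rightarrow> 'v) \<Rightarrow> 'm \<Rightarrow> real"
  where "pairing g \<phi> \<psi> = (\<lambda>x. g x (\<phi> x) (\<psi> x))"

definition split_signature ::
    "('m, 'v::real_vector) vbundle \<Rightarrow> ('m \<Rightarrow> 'v \<Rightarrow> 'v \<Rightarrow> real) \<Rightarrow> bool"
  where "split_signature E g \<longleftrightarrow>
    (\<exists>n. vrank E = 2 * n \<and>
      (\<forall>x. \<exists>e. span (e ` {..<2 * n}) = fibre E x \<and>
        (\<forall>i<2 * n. \<forall>j<2 * n.
           g x (e i) (e j) = (if i \<noteq> j then 0 else if i < n then 1 else - 1))))"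

text \<open>
  The identification of the dual of the fibre over \<open>x\<close> with the fibre itself by means of the
  metric.
\<close>

definition sharp ::
    "('m, 'v) vbundle \<Rightarrow> ('m \<Rightarrow> 'v \<Rightarrow> 'v \<Rightarrow> real) \<Rightarrow> 'm \<Rightarrow> ('v \<Rightarrow> real) \<Rightarrow> 'v"
  where "sharp E g x \<theta> = (THE u. u \<in> fibre E x \<and> (\<forall>v\<in>fibre E x. g x u v = \<theta> v))"

text \<open>
  Sections of the \<open>p\<close>-th exterior power of \<open>E\<close> are regarded as alternating \<open>p\<close>-forms on \<open>E\<close>:
  \<open>\<alpha> x [e\<^sub>1, \<dots>, e\<^sub>p]\<close> is the evaluation of \<open>\<alpha>\<close> at \<open>x\<close> on the wedge product of the \<open>e\<^sub>i\<close>. Only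
  the values on lists of length \<open>p\<close> of elements of the fibre matter. For \<open>p = 0\<close> this is a
  smooth function \<open>\<lambda>x. \<alpha> x []\<close>.
\<close>

type_synonym ('m, 'v) form = "'m \<Rightarrow> 'v list \<Rightarrow> real"

definition alternating_form :: "'v::real_vector set \<Rightarrow> nat \<Rightarrow> ('v list \<Rightarrow> real) \<Rightarrow> bool"
  where "alternating_form V p \<alpha> \<longleftrightarrow>
    (\<forall>es. length es = p \<and> set es \<subseteq> V \<longrightarrow>
       (\<forall>i<p. lin_on V (\<lambda>e. \<alpha> (es[i := e]))) \<and>
       (\<forall>i j. i < j \<and> j < p \<and> es ! i = es ! j \<longrightarrow> \<alpha> es = 0))"

definition wedge_sections ::
    "'m manifold \<Rightarrow> ('m, 'v::real_vector) vbundle \<Rightarrow> nat \<Rightarrow> ('m, 'v) form set"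
  where "wedge_sections M E p = {\<alpha>.
    (\<forall>x. alternating_form (fibre E x) p (\<alpha> x)) \<and>
    (\<forall>(U, \<Phi>)\<in>trivs E. \<forall>js. length js = p \<and> set js \<subseteq> {..<vrank E} \<longrightarrow>
       smooth_on M U (\<lambda>x. \<alpha> x (map (\<lambda>j. frame E \<Phi> j x) js)))}"

definition form_eval :: "('m, 'v) form \<Rightarrow> ('m \<Rightarrow> 'v) list \<Rightarrow> 'm \<Rightarrow> real"
  where "form_eval \<alpha> \<psi>s = (\<lambda>x. \<alpha> x (map (\<lambda>\<psi>. \<psi> x) \<psi>s))"

text \<open>
  The map from the \<open>p\<close>-th exterior power of \<open>E\<close> to tangent-vector-valued \<open>(p - 1)\<close>-forms, at
  the point \<open>x\<close>: the first slot of the form is turned into an element of the fibre, to which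
  the anchor is applied. The lemma \<open>rho_tilde_wedge\<close> below shows that on decomposable elements
  this is the usual formula.
\<close>

definition rho_tilde ::
    "('m, 'v) vbundle \<Rightarrow> ('m \<Rightarrow> 'v \<Rightarrow> 'v \<Rightarrow> real) \<Rightarrow> ('m, 'v) anchor \<Rightarrow> 'm \<Rightarrow>
     ('v list \<Rightarrow> real) \<Rightarrow> 'v list \<Rightarrow> ('m \<Rightarrow> real) \<Rightarrow> real"
  where "rho_tilde E g \<rho> x \<alpha> es = \<rho> x (sharp E g x (\<lambda>e. \<alpha> (e # es)))"

text \<open>
  The form corresponding to the wedge product of \<open>us\<close> is the determinant of the matrix of
  pairings, here in its Laplace expansion along the first argument.
\<close>

fun wedge :: "('v \<Rightarrow> 'v \<Rightarrow> real) \<Rightarrow> 'v list \<Rightarrow> 'v list \<Rightarrow> real"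
  where
    "wedge h us [] = 1"
  | "wedge h us (e # es) = (\<Sum>i<length us. (- 1) ^ i * h (us ! i) e * wedge h (omit i us) es)"

lemma lin_on_sum:
  assumes "lin_on V f" "subspace V" "finite I" "\<And>i. i \<in> I \<Longrightarrow> u i \<in> V"
  shows "f (\<Sum>i\<in>I. c i *\<^sub>R u i) = (\<Sum>i\<in>I. c i *\<^sub>R f (u i))"
  using assms(3,4)
proof (induction I rule: finite_induct)
  case empty
  have "f (0 *\<^sub>R 0) = 0 *\<^sub>R f 0"
    using assms(1) subspace_0[OF assms(2)] unfolding lin_on_def by blast
  then show ?case by simp
next
  case (insert i I)
  have "c i *\<^sub>R u i \<in> V" "(\<Sum>i\<in>I. c i *\<^sub>R u i) \<in> V"
    using insert.prems assms(2) by (auto intro!: subspace_sum subspace_scale)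
  with insert assms(1) show ?case
    unfolding lin_on_def by simp
qed

lemma sharp_eqI:
  assumes "fibre_metric M E g" "subspace (fibre E x)" "u \<in> fibre E x"
    and "\<And>v. v \<in> fibre E x \<Longrightarrow> g x u v = \<theta> v"
  shows "sharp E g x \<theta> = u"
  unfolding sharp_def
proof (rule the_equality)
  fix w assume w: "w \<in> fibre E x \<and> (\<forall>v\<in>fibre E x. g x w v = \<theta> v)"
  have mem: "- 1 *\<^sub>R u \<in> fibre E x" "w + - 1 *\<^sub>R u \<in> fibre E x"
    using w assms(2,3) by (auto intro!: subspace_neg subspace_diff)
  have "g x (w + - 1 *\<^sub>R u) v = 0" if v: "v \<in> fibre E x" for v
  proof -
    have "g x (w + - 1 *\<^sub>R u) v = g x v (w + - 1 *\<^sub>R u)"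
      using assms(1) mem(2) v unfolding fibre_metric_def by blast
    also have "\<dots> = g x v w + g x v (- 1 *\<^sub>R u)"
      using assms(1) mem(1) v w unfolding fibre_metric_def lin_on_def by blast
    also have "g x v (- 1 *\<^sub>R u) = - 1 *\<^sub>R g x v u"
      using assms(1,3) v unfolding fibre_metric_def lin_on_def by blast
    also have "g x v w = g x w v"
      using assms(1) v w unfolding fibre_metric_def by blast
    also have "g x v u = g x u v"
      using assms(1,3) v unfolding fibre_metric_def by blast
    finally show ?thesis using w v assms(4) by simp
  qed
  then have "w + - 1 *\<^sub>R u = 0"
    using assms(1) mem(2) unfolding fibre_metric_def by blast
  then show "w = u" by simp
qed (use assms in blast)

lemma rho_tilde_wedge:
  assumes g: "fibre_metric M E g" and V: "subspace (fibre E x)"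
    and \<rho>: "lin_on (fibre E x) (\<rho> x)" and us: "set us \<subseteq> fibre E x"
  shows "rho_tilde E g \<rho> x (wedge (g x) us) es =
    (\<Sum>i<length us. ((- 1) ^ i * wedge (g x) (omit i us) es) *\<^sub>R \<rho> x (us ! i))"
proof -
  let ?c = "\<lambda>i. (- 1) ^ i * wedge (g x) (omit i us) es"
  let ?u = "\<Sum>i<length us. ?c i *\<^sub>R (us ! i)"
  have ui: "us ! i \<in> fibre E x" if "i \<in> {..<length us}" for i
    using us that by auto
  have u: "?u \<in> fibre E x"
    using ui V by (auto intro!: subspace_sum subspace_scale)
  have "sharp E g x (\<lambda>e. wedge (g x) us (e # es)) = ?u"
  proof (rule sharp_eqI[OF g V u])
    fix v assume v: "v \<in> fibre E x"
    have "g x ?u v = g x v ?u"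
      using g u v unfolding fibre_metric_def by blast
    also have "\<dots> = (\<Sum>i<length us. ?c i *\<^sub>R g x v (us ! i))"
      using g v by (intro lin_on_sum[OF _ V _ ui]) (auto simp: fibre_metric_def)
    also have "\<dots> = (\<Sum>i<length us. (- 1) ^ i * g x (us ! i) v * wedge (g x) (omit i us) es)"
    proof (rule sum.cong[OF refl])
      fix i assume "i \<in> {..<length us}"
      then have "g x v (us ! i) = g x (us ! i) v"
        using g v ui unfolding fibre_metric_def by blast
      then show "?c i *\<^sub>R g x v (us ! i) = (- 1) ^ i * g x (us ! i) v * wedge (g x) (omit i us) es"
        by simp
    qed
    finally show "g x ?u v = wedge (g x) us (v # es)" by simp
  qed
  moreover have "\<rho> x ?u = (\<Sum>i<length us. ?c i *\<^sub>R \<rho> x (us ! i))"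
    by (rule lin_on_sum[OF \<rho> V finite_lessThan ui])
  ultimately show ?thesis
    unfolding rho_tilde_def by simp
qed

text \<open>
  The space of sections of the \<open>p\<close>-th exterior power in the kernel of the map above, which for
  \<open>p = 0\<close> is the space of all smooth functions.
\<close>

definition kernel_forms ::
    "'m manifold \<Rightarrow> ('m, 'v::real_vector) vbundle \<Rightarrow> ('m \<Rightarrow> 'v \<Rightarrow> 'v \<Rightarrow> real) \<Rightarrow>
     ('m, 'v) anchor \<Rightarrow> nat \<Rightarrow> ('m, 'v) form set"
  where "kernel_forms M E g \<rho> p = {\<alpha> \<in> wedge_sections M E p.
    \<forall>x es. Suc (length es) = p \<and> set es \<subseteq> fibre E x \<longrightarrow> rho_tilde E g \<rho> x (\<alpha> x) es = 0}"


section \<open>Twisted Courant algebroids\<close>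

type_synonym ('m, 'v) bracket = "('m \<Rightarrow> 'v) \<Rightarrow> ('m \<Rightarrow> 'v) \<Rightarrow> 'm \<Rightarrow> 'v"

text \<open>Only the values of the bracket on sections of \<open>E\<close> matter.\<close>

definition bracket_on ::
    "'m manifold \<Rightarrow> ('m, 'v::real_vector) vbundle \<Rightarrow> ('m, 'v) bracket \<Rightarrow> bool"
  where "bracket_on M E br \<longleftrightarrow>
    (\<forall>\<phi>\<in>sections M E. (\<forall>\<psi>\<in>sections M E. br \<phi> \<psi> \<in> sections M E) \<and>
       lin_on (sections M E) (br \<phi>) \<and> lin_on (sections M E) (\<lambda>\<psi>. br \<psi> \<phi>))"

text \<open>
  The operator \<open>\<D>\<close> applied to a \<open>p\<close>-form and evaluated on \<open>p + 1\<close> sections.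
\<close>

definition courant_D ::
    "('m, 'v) anchor \<Rightarrow> ('m, 'v) bracket \<Rightarrow> ('m, 'v) form \<Rightarrow> ('m \<Rightarrow> 'v) list \<Rightarrow> 'm \<Rightarrow> real"
  where "courant_D \<rho> br \<alpha> \<psi>s =
    (\<lambda>x. (\<Sum>i<length \<psi>s. (- 1) ^ i * act \<rho> (\<psi>s ! i) (form_eval \<alpha> (omit i \<psi>s)) x) +
         (\<Sum>j<length \<psi>s. \<Sum>i<j. (- 1) ^ (i + j) *
            form_eval \<alpha> (br (\<psi>s ! i) (\<psi>s ! j) # omit i (omit j \<psi>s)) x))"

text \<open>
  For a \<open>(p + 1)\<close>-form \<open>H\<close>, the \<open>p\<close>-form with values in \<open>E\<close> that \<open>H\<close> induces through the metric
  in its last slot.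
\<close>

definition induced_twist ::
    "('m, 'v) vbundle \<Rightarrow> ('m \<Rightarrow> 'v \<Rightarrow> 'v \<Rightarrow> real) \<Rightarrow> ('m, 'v) form \<Rightarrow> ('m \<Rightarrow> 'v) list \<Rightarrow> 'm \<Rightarrow> 'v"
  where "induced_twist E g H \<psi>s = (\<lambda>x. sharp E g x (\<lambda>e. H x (map (\<lambda>\<psi>. \<psi> x) \<psi>s @ [e])))"

text \<open>
  In the fourth axiom for the bracket, the one-form \<open>\<D>\<langle>\<psi>, \<psi>\<rangle>\<close> is identified with a section of
  \<open>E\<close> by the metric, i.e. the equation is tested against all sections \<open>\<eta>\<close>.
\<close>

definition twisted_courant_algebroid ::
    "'m::{t2_space,second_countable_topology} manifold \<Rightarrow> ('m, 'v::real_vector) vbundle \<Rightarrow>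
     ('m, 'v) bracket \<Rightarrow> ('m \<Rightarrow> 'v \<Rightarrow> 'v \<Rightarrow> real) \<Rightarrow> ('m, 'v) anchor \<Rightarrow> ('m, 'v) form \<Rightarrow> bool"
  where "twisted_courant_algebroid M E br g \<rho> H \<longleftrightarrow>
    vector_bundle M E \<and> fibre_metric M E g \<and> bracket_on M E br \<and>
    bundle_map M E (tangent_bundle M) \<rho> \<and> H \<in> kernel_forms M E g \<rho> 4 \<and>
    (\<forall>\<phi>\<in>sections M E. \<forall>\<psi>\<^sub>1\<in>sections M E. \<forall>\<psi>\<^sub>2\<in>sections M E.
       induced_twist E g H [\<phi>, \<psi>\<^sub>1, \<psi>\<^sub>2] =
         br \<phi> (br \<psi>\<^sub>1 \<psi>\<^sub>2) - br (br \<phi> \<psi>\<^sub>1) \<psi>\<^sub>2 - br \<psi>\<^sub>1 (br \<phi> \<psi>\<^sub>2)) \<and>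
    (\<forall>\<psi>s. length \<psi>s = 5 \<and> set \<psi>s \<subseteq> sections M E \<longrightarrow> courant_D \<rho> br H \<psi>s = 0) \<and>
    (\<forall>\<phi>\<in>sections M E. \<forall>\<psi>\<in>sections M E. \<forall>f\<in>smooth_functions M.
       br \<phi> (fscale f \<psi>) = fscale (act \<rho> \<phi> f) \<psi> + fscale f (br \<phi> \<psi>)) \<and>
    (\<forall>\<psi>\<in>sections M E. \<forall>\<eta>\<in>sections M E.
       pairing g (br \<psi> \<psi>) \<eta> = (1 / 2) *\<^sub>R courant_D \<rho> br (\<lambda>x _. pairing g \<psi> \<psi> x) [\<eta>]) \<and>
    (\<forall>\<phi>\<in>sections M E. \<forall>\<psi>\<in>sections M E.
       act \<rho> \<phi> (pairing g \<psi> \<psi>) = 2 *\<^sub>R pairing g (br \<phi> \<psi>) \<psi>)"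


section \<open>Isotropic subbundles and Dirac structures\<close>

definition isotropic_subbundle ::
    "'m::{t2_space,second_countable_topology} manifold \<Rightarrow> ('m, 'v::real_vector) vbundle \<Rightarrow>
     ('m \<Rightarrow> 'v \<Rightarrow> 'v \<Rightarrow> real) \<Rightarrow> ('m, 'v) vbundle \<Rightarrow> bool"
  where "isotropic_subbundle M E g L \<longleftrightarrow>
    subbundle M E L \<and> (\<forall>x. \<forall>u\<in>fibre L x. \<forall>v\<in>fibre L x. g x u v = 0)"

definition integrable_subbundle ::
    "'m manifold \<Rightarrow> ('m, 'v) bracket \<Rightarrow> ('m, 'v::real_vector) vbundle \<Rightarrow> bool"
  where "integrable_subbundle M br L \<longleftrightarrow>
    (\<forall>\<phi>\<in>sections M L. \<forall>\<psi>\<in>sections M L. br \<phi> \<psi> \<in> sections M L)"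

definition dirac_structure ::
    "'m::{t2_space,second_countable_topology} manifold \<Rightarrow> ('m, 'v::real_vector) vbundle \<Rightarrow>
     ('m, 'v) bracket \<Rightarrow> ('m \<Rightarrow> 'v \<Rightarrow> 'v \<Rightarrow> real) \<Rightarrow> ('m, 'v) vbundle \<Rightarrow> bool"
  where "dirac_structure M E br g L \<longleftrightarrow>
    isotropic_subbundle M E g L \<and>
    (\<forall>L'. isotropic_subbundle M E g L' \<and> (\<forall>x. fibre L x \<subseteq> fibre L' x) \<longrightarrow> fibre L' = fibre L) \<and>
    integrable_subbundle M br L"


section \<open>Twisted Lie algebroids\<close>

definition kernel_sections ::
    "'m manifold \<Rightarrow> ('m, 'v::real_vector) vbundle \<Rightarrow> ('m, 'v) anchor \<Rightarrow> ('m \<Rightarrow> 'v) set"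
  where "kernel_sections M A \<rho> = {v \<in> sections M A. \<forall>x. \<rho> x (v x) = 0}"

text \<open>
  Alternating \<open>p\<close>-forms on the module of sections of \<open>A\<close> over the ring of smooth functions,
  with values in the sections of the kernel of the anchor.
\<close>

definition kernel_valued_forms ::
    "'m manifold \<Rightarrow> ('m, 'v::real_vector) vbundle \<Rightarrow> ('m, 'v) anchor \<Rightarrow> nat \<Rightarrow>
     (('m \<Rightarrow> 'v) list \<Rightarrow> 'm \<Rightarrow> 'v) set"
  where "kernel_valued_forms M A \<rho> p = {\<omega>.
    \<forall>\<psi>s. length \<psi>s = p \<and> set \<psi>s \<subseteq> sections M A \<longrightarrow>
      \<omega> \<psi>s \<in> kernel_sections M A \<rho> \<and>
      (\<forall>i<p. \<forall>\<phi>\<in>sections M A. \<forall>\<eta>\<in>sections M A.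
         \<omega> (\<psi>s[i := \<phi> + \<eta>]) = \<omega> (\<psi>s[i := \<phi>]) + \<omega> (\<psi>s[i := \<eta>])) \<and>
      (\<forall>i<p. \<forall>\<phi>\<in>sections M A. \<forall>f\<in>smooth_functions M.
         \<omega> (\<psi>s[i := fscale f \<phi>]) = fscale f (\<omega> (\<psi>s[i := \<phi>]))) \<and>
      (\<forall>i j. i < j \<and> j < p \<and> \<psi>s ! i = \<psi>s ! j \<longrightarrow> \<omega> \<psi>s = 0)}"

text \<open>
  The operator \<open>D\<close> of the connection \<open>\<nabla>\<^sub>\<psi> v = [\<psi>, v]\<close> on the kernel of the anchor, applied to
  a \<open>p\<close>-form and evaluated on \<open>p + 1\<close> sections.
\<close>

definition lie_D ::
    "('m, 'v::real_vector) bracket \<Rightarrow> (('m \<Rightarrow> 'v) list \<Rightarrow> 'm \<Rightarrow> 'v) \<Rightarrow> ('m \<Rightarrow> 'v) list \<Rightarrow> 'm \<Rightarrow> 'v"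
  where "lie_D br \<omega> \<psi>s =
    (\<Sum>i<length \<psi>s. (- 1) ^ i *\<^sub>R br (\<psi>s ! i) (\<omega> (omit i \<psi>s))) +
    (\<Sum>j<length \<psi>s. \<Sum>i<j. (- 1) ^ (i + j) *\<^sub>R
       \<omega> (br (\<psi>s ! i) (\<psi>s ! j) # omit i (omit j \<psi>s)))"

definition D_closed ::
    "'m manifold \<Rightarrow> ('m, 'v::real_vector) vbundle \<Rightarrow> ('m, 'v) bracket \<Rightarrow> nat \<Rightarrow>
     (('m \<Rightarrow> 'v) list \<Rightarrow> 'm \<Rightarrow> 'v) \<Rightarrow> bool"
  where "D_closed M A br p \<omega> \<longleftrightarrow>
    (\<forall>\<psi>s. length \<psi>s = Suc p \<and> set \<psi>s \<subseteq> sections M A \<longrightarrow> lie_D br \<omega> \<psi>s = 0)"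

text \<open>
  All conditions involve the bracket on sections of \<open>A\<close> and the anchor on the fibres of \<open>A\<close>
  only. For a subbundle \<open>L\<close> of \<open>E\<close>, restricting bracket and anchor to \<open>L\<close> therefore amounts to
  using those of \<open>E\<close> with \<open>A = L\<close>.
\<close>

definition twisted_lie_algebroid ::
    "'m::{t2_space,second_countable_topology} manifold \<Rightarrow> ('m, 'v::real_vector) vbundle \<Rightarrow>
     ('m, 'v) bracket \<Rightarrow> ('m, 'v) anchor \<Rightarrow> (('m \<Rightarrow> 'v) list \<Rightarrow> 'm \<Rightarrow> 'v) \<Rightarrow> bool"
  where "twisted_lie_algebroid M A br \<rho> H\<^sub>A \<longleftrightarrow>
    vector_bundle M A \<and> bundle_map M A (tangent_bundle M) \<rho> \<and>
    H\<^sub>A \<in> kernel_valued_forms M A \<rho> 3 \<and> bracket_on M A br \<and>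
    (\<forall>\<phi>\<in>sections M A. \<forall>\<psi>\<in>sections M A. br \<phi> \<psi> = - br \<psi> \<phi>) \<and>
    (\<forall>\<phi>\<in>sections M A. \<forall>\<psi>\<^sub>1\<in>sections M A. \<forall>\<psi>\<^sub>2\<in>sections M A.
       br \<phi> (br \<psi>\<^sub>1 \<psi>\<^sub>2) = br (br \<phi> \<psi>\<^sub>1) \<psi>\<^sub>2 + br \<psi>\<^sub>1 (br \<phi> \<psi>\<^sub>2) + H\<^sub>A [\<phi>, \<psi>\<^sub>1, \<psi>\<^sub>2]) \<and>
    (\<forall>\<phi>\<in>sections M A. \<forall>\<psi>\<in>sections M A. \<forall>f\<in>smooth_functions M.
       br \<phi> (fscale f \<psi>) = fscale (act \<rho> \<phi> f) \<psi> + fscale f (br \<phi> \<psi>)) \<and>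
    D_closed M A br 3 H\<^sub>A"

end

theory Submission
  imports Defs
begin

text \<open>
  On sections of a Dirac structure \<open>L\<close> the bracket is skew-symmetric: its symmetric part is the
  differential of \<open>\<langle>\<psi>, \<psi>\<rangle>\<close>, which is zero as \<open>L\<close> is isotropic (\<open>isotropic_bracket_self_zero\<close>).
  The axiom states this only after pairing with sections of \<open>E\<close>, so one needs a global section
  through every vector of \<open>E\<close>, and these are built from bump functions
  (\<open>ex_bump_function\<close>, \<open>ex_section_through\<close>, \<open>fibre_metric_zeroI\<close>).

  The first axiom of the Courant algebroid says that the twist is the Jacobiator of the bracket.
  As \<open>L\<close> is integrable, the twist therefore maps sections of \<open>L\<close> to sections of \<open>L\<close>, and the
  twisted Jacobi identity holds on \<open>L\<close>. The values of the twist lie in the kernel of the anchor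
  because \<open>H\<close> is a form on that kernel (\<open>anchor_induced_twist\<close>), and the twist is alternating and
  linear over smooth functions because it is defined fibrewise (\<open>induced_twist_kernel_valued\<close>).
  The Leibniz rule is inherited from \<open>E\<close>.

  Closedness under \<open>D\<close> is again a consequence of the twist being the Jacobiator: the Jacobiator of
  any skew-symmetric bracket is closed under the operator \<open>D\<close> formed with that bracket
  (\<open>jacobiator_closed\<close>).

  It remains to see that sections of \<open>L\<close> are sections of \<open>E\<close> and that the anchor restricts to a
  bundle map on \<open>L\<close>. Both are local computations in frames (\<open>bundle_map_sections\<close>,
  \<open>bundle_map_comp\<close>).
\<close>


section \<open>Smooth functions on open subsets of Euclidean space\<close>

lemma openin_Euclidean_spaceE:
  assumes "openin (Euclidean_space n) S"
  obtains T where "open T" "S = T \<inter> topspace (Euclidean_space n)"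
proof -
  have "openin (subtopology euclidean {x::nat \<Rightarrow> real. \<forall>i\<ge>n. x i = 0}) S"
    using assms unfolding Euclidean_space_def by (simp only: euclidean_product_topology)
  then show thesis
    using that unfolding openin_subtopology topspace_Euclidean_space by auto
qed

lemma has_partial_imp_DERIV:
  assumes "has_partial i f z"
  shows "((\<lambda>t. f (z(i := t))) has_real_derivative partial i f z) (at (z i))"
  using assms unfolding has_partial_def partial_def
  by (simp add: DERIV_deriv_iff_real_differentiable)

lemma DERIV_imp_partial:
  assumes "((\<lambda>t. f (z(i := t))) has_real_derivative D) (at (z i))"
  shows "has_partial i f z" "partial i f z = D"
  using assms unfolding has_partial_def partial_def
  by (auto simp: DERIV_imp_deriv real_differentiable_def)

text \<open>
  Points of the model space vanish from index \<open>n\<close> on, so openness only controls changes of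
  the first \<open>n\<close> coordinates. This is what makes partial derivatives local.
\<close>

lemma eventually_fun_upd_in:
  assumes S: "openin (Euclidean_space n) S" and z: "z \<in> S" and i: "i < n"
  shows "\<forall>\<^sub>F t in nhds (z i). z(i := t) \<in> S"
proof -
  obtain T where T: "open T" "S = T \<inter> topspace (Euclidean_space n)"
    using S by (rule openin_Euclidean_spaceE)
  have "continuous_on UNIV (\<lambda>t. (z(i := t)) j)" for j
    by (cases "j = i") (auto intro: continuous_intros)
  then have "continuous_on UNIV (\<lambda>t. z(i := t))"
    by (intro continuous_on_coordinatewise_then_product)
  then have "open ((\<lambda>t. z(i := t)) -` T)"
    using T(1) open_vimage by blast
  moreover have "z i \<in> (\<lambda>t. z(i := t)) -` T"
    using z T(2) by simp
  ultimately have "\<forall>\<^sub>F t in nhds (z i). z(i := t) \<in> T"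
    unfolding eventually_nhds by blast
  moreover have "z(i := t) \<in> topspace (Euclidean_space n)" for t
    using z T(2) i by (auto simp: topspace_Euclidean_space)
  ultimately show ?thesis
    by (simp add: T(2))
qed

lemma partial_cong:
  assumes S: "openin (Euclidean_space n) S" and eq: "\<And>z. z \<in> S \<Longrightarrow> f z = h z"
    and z: "z \<in> S" and i: "i < n" and f: "has_partial i f z"
  shows "has_partial i h z" "partial i h z = partial i f z"
proof -
  have ev: "\<forall>\<^sub>F t in nhds (z i). f (z(i := t)) = h (z(i := t))"
    using eventually_fun_upd_in[OF S z i] by eventually_elim (rule eq)
  have "((\<lambda>t. h (z(i := t))) has_real_derivative partial i f z) (at (z i))"
    using has_partial_imp_DERIV[OF f] DERIV_cong_ev[OF refl ev refl] by blast
  then show "has_partial i h z" "partial i h z = partial i f z"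
    by (rule DERIV_imp_partial)+
qed

lemma Ck_on_cong:
  assumes "Ck_on n k S f" "openin (Euclidean_space n) S" "\<And>z. z \<in> S \<Longrightarrow> f z = h z"
  shows "Ck_on n k S h"
  using assms
proof (induction k arbitrary: f h)
  case 0
  then show ?case using continuous_on_cong[of S S f h] by simp
next
  case (Suc k)
  have p: "has_partial i h z" "partial i h z = partial i f z" if "i < n" "z \<in> S" for i z
    using partial_cong[OF Suc.prems(2,3)] that Suc.prems(1) by auto
  moreover have "Ck_on n k S (partial i h)" if "i < n" for i
    by (rule Suc.IH[of "partial i f"]) (use Suc.prems that p in auto)
  ultimately show ?case
    using Suc.prems continuous_on_cong[of S S f h] by auto
qed

lemma Ck_on_subset: "Ck_on n k S f \<Longrightarrow> T \<subseteq> S \<Longrightarrow> Ck_on n k T f"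
  by (induction k arbitrary: f) (auto intro: continuous_on_subset)

lemma Ck_on_continuous: "Ck_on n k S f \<Longrightarrow> continuous_on S f"
  by (cases k) auto

lemma Ck_on_SucD: "Ck_on n (Suc k) S f \<Longrightarrow> Ck_on n k S f"
proof (induction k arbitrary: f)
  case (Suc k)
  then show ?case by (metis Ck_on.simps(2))
qed simp

text \<open>
  Smoothness is a local property: continuity because the pieces are relatively open, and the
  partial derivatives because they are taken pointwise and do not depend on the piece.
\<close>

lemma Ck_on_locally:
  assumes "S \<subseteq> topspace (Euclidean_space n)"
    and "\<And>z. z \<in> S \<Longrightarrow> \<exists>T. openin (Euclidean_space n) T \<and> z \<in> T \<and> T \<subseteq> S \<and> Ck_on n k T f"
  shows "Ck_on n k S f"
  using assms
proof (induction k arbitrary: f)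
  case (0 f)
  have "continuous (at z within S) f" if z: "z \<in> S" for z
  proof -
    obtain T where T: "openin (Euclidean_space n) T" "z \<in> T" "T \<subseteq> S" "continuous_on T f"
      using 0(2)[OF z] by auto
    obtain O' where O': "open O'" "T = O' \<inter> topspace (Euclidean_space n)"
      using T(1) by (rule openin_Euclidean_spaceE)
    have "T \<inter> O' - {z} = S \<inter> O' - {z}"
      using O'(2) T(3) "0"(1) by blast
    then have "at z within T = at z within S"
      using O' T(2) by (intro at_within_nhd[of z O']) auto
    then show ?thesis
      using T(2,4) by (auto simp: continuous_on_eq_continuous_within)
  qed
  then show ?case by (simp add: continuous_on_eq_continuous_within)
next
  case (Suc k f)
  have "Ck_on n k S f"
  proof (rule Suc.IH[OF Suc.prems(1)])
    fix z assume "z \<in> S"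
    then obtain T where "openin (Euclidean_space n) T" "z \<in> T" "T \<subseteq> S" "Ck_on n (Suc k) T f"
      using Suc.prems(2) by meson
    then show "\<exists>T. openin (Euclidean_space n) T \<and> z \<in> T \<and> T \<subseteq> S \<and> Ck_on n k T f"
      using Ck_on_SucD by metis
  qed
  then have "continuous_on S f"
    by (rule Ck_on_continuous)
  moreover have "has_partial i f z" if "i < n" "z \<in> S" for i z
  proof -
    obtain T where "z \<in> T" "Ck_on n (Suc k) T f"
      using Suc.prems(2) \<open>z \<in> S\<close> by meson
    then show ?thesis using that by simp
  qed
  moreover have "Ck_on n k S (partial i f)" if "i < n" for i
  proof (rule Suc.IH[OF Suc.prems(1)])
    fix z assume "z \<in> S"
    then obtain T where "openin (Euclidean_space n) T" "z \<in> T" "T \<subseteq> S" "Ck_on n (Suc k) T f"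
      using Suc.prems(2) by meson
    with that show "\<exists>T. openin (Euclidean_space n) T \<and> z \<in> T \<and> T \<subseteq> S \<and> Ck_on n k T (partial i f)"
      by (metis Ck_on.simps(2))
  qed
  ultimately show ?case by simp
qed

lemma Ck_on_const: "Ck_on n k S (\<lambda>z. c)"
proof (induction k arbitrary: c)
  case (Suc k)
  have "has_partial i (\<lambda>z. c) z" "partial i (\<lambda>z. c) z = 0" for i z
    using DERIV_imp_partial[of "\<lambda>z. c" z i 0] by simp_all
  moreover from this have "partial i (\<lambda>z. c) = (\<lambda>z. 0)" for i
    by (intro ext)
  ultimately show ?case
    using Suc[of 0] by simp
qed simp

lemma Ck_on_add:
  assumes "openin (Euclidean_space n) S" "Ck_on n k S f" "Ck_on n k S h"
  shows "Ck_on n k S (\<lambda>z. f z + h z)"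
  using assms(2,3)
proof (induction k arbitrary: f h)
  case 0
  then show ?case by (auto intro: continuous_intros)
next
  case (Suc k)
  have p: "has_partial i (\<lambda>z. f z + h z) z"
    "partial i (\<lambda>z. f z + h z) z = partial i f z + partial i h z" if "i < n" "z \<in> S" for i z
    using DERIV_add[OF has_partial_imp_DERIV[of i f z] has_partial_imp_DERIV[of i h z]]
      Suc.prems that
    by (auto intro!: DERIV_imp_partial)
  have "Ck_on n k S (partial i (\<lambda>z. f z + h z))" if "i < n" for i
    by (rule Ck_on_cong[where f = "\<lambda>z. partial i f z + partial i h z"])
      (use Suc that p assms(1) in auto)
  then show ?case
    using Suc.prems p by (auto intro: continuous_intros)
qed

lemma Ck_on_mult:
  assumes "openin (Euclidean_space n) S" "Ck_on n k S f" "Ck_on n k S h"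
  shows "Ck_on n k S (\<lambda>z. f z * h z)"
  using assms(2,3)
proof (induction k arbitrary: f h)
  case 0
  then show ?case by (auto intro: continuous_intros)
next
  case (Suc k)
  have p: "has_partial i (\<lambda>z. f z * h z) z"
    "partial i (\<lambda>z. f z * h z) z = partial i f z * h z + partial i h z * f z"
    if "i < n" "z \<in> S" for i z
    using DERIV_mult[OF has_partial_imp_DERIV[of i f z] has_partial_imp_DERIV[of i h z]]
      Suc.prems that
    by (auto intro!: DERIV_imp_partial)
  have "Ck_on n k S (partial i (\<lambda>z. f z * h z))" if "i < n" for i
  proof (rule Ck_on_cong[where f = "\<lambda>z. partial i f z * h z + partial i h z * f z"])
    show "Ck_on n k S (\<lambda>z. partial i f z * h z + partial i h z * f z)"
      using Suc.prems Suc.prems[THEN Ck_on_SucD] that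
      by (intro Ck_on_add[OF assms(1)] Suc.IH) auto
  qed (use that p assms(1) in auto)
  then show ?case
    using Suc.prems p by (auto intro: continuous_intros)
qed

text \<open>
  The functions \<open>t\<^sup>-\<^sup>m exp (- 1 / t)\<close>, extended by zero to \<open>t \<le> 0\<close>. The powers of \<open>1 / t\<close> are
  there so that the span of the family is closed under differentiation; smoothness of all
  members can then be proved by one induction on the order of differentiability.
\<close>

definition flat :: "nat \<Rightarrow> real \<Rightarrow> real"
  where "flat m t = (if t \<le> 0 then 0 else inverse t ^ m * exp (- inverse t))"

lemma flat_pos: "0 < t \<Longrightarrow> 0 < flat m t"
  by (simp add: flat_def)

lemma flat_nonpos: "t \<le> 0 \<Longrightarrow> flat m t = 0"
  by (simp add: flat_def)

lemma tendsto_flat_0: "(flat m \<longlongrightarrow> 0) (at 0)"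
proof -
  have "((\<lambda>t. inverse t ^ m / exp (inverse t)) \<longlongrightarrow> (0::real)) (at_right 0)"
    by (rule filterlim_compose[OF tendsto_power_div_exp_0 filterlim_inverse_at_top_right])
  then have "(flat m \<longlongrightarrow> 0) (at_right 0)"
    by (rule Lim_transform_eventually)
      (use eventually_at_right_less[of "0::real"] in
        \<open>eventually_elim, simp add: flat_def exp_minus divide_inverse\<close>)
  moreover have "(flat m \<longlongrightarrow> 0) (at_left 0)"
    by (rule tendsto_eventually)
      (auto simp: flat_def eventually_at_filter intro!: always_eventually)
  ultimately show ?thesis
    using filterlim_split_at_real by blast
qed

text \<open>
  At \<open>t = 0\<close> the difference quotient of \<open>flat m\<close> is \<open>flat (Suc m)\<close>, which tends to zero.
\<close>

lemma DERIV_flat: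
  "(flat m has_real_derivative flat (m + 2) t - real m * flat (Suc m) t) (at t)"
proof (cases t "0::real" rule: linorder_cases)
  case less
  have "((\<lambda>t. 0) has_real_derivative 0) (at t)" by simp
  moreover have "\<forall>\<^sub>F s in nhds t. 0 = flat m s"
    using eventually_nhds_in_open[of "{..<0}" t] less
    by (auto simp: flat_nonpos elim!: eventually_mono)
  ultimately show ?thesis
    using less DERIV_cong_ev[of t t "\<lambda>t. 0" "flat m" 0 0] by (simp add: flat_nonpos)
next
  case equal
  have "((\<lambda>h. flat (Suc m) h) \<longlongrightarrow> 0) (at 0)"
    by (rule tendsto_flat_0)
  then have "((\<lambda>h. (flat m (0 + h) - flat m 0) / h) \<longlongrightarrow> 0) (at 0)"
    by (rule Lim_transform_eventually)
      (simp add: flat_def divide_inverse)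
  then show ?thesis
    using equal by (simp add: DERIV_def flat_nonpos)
next
  case greater
  have "((\<lambda>t. inverse t ^ m * exp (- inverse t)) has_real_derivative
      flat (m + 2) t - real m * flat (Suc m) t) (at t)"
  proof -
    have "((\<lambda>t. inverse t ^ m * exp (- inverse t)) has_real_derivative
        (real m * inverse t ^ (m - Suc 0)) * (- (inverse t * 1 * inverse t)) * exp (- inverse t)
        + (exp (- inverse t) * (- (- (inverse t * 1 * inverse t)))) * inverse t ^ m) (at t)"
      using greater by (intro DERIV_mult DERIV_chain2[OF DERIV_exp] DERIV_minus
          DERIV_inverse' DERIV_chain2[OF DERIV_pow] DERIV_ident) auto
    moreover have "(real m * inverse t ^ (m - Suc 0)) * (- (inverse t * 1 * inverse t)) * exp (- inverse t)
        + (exp (- inverse t) * (- (- (inverse t * 1 * inverse t)))) * inverse t ^ m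
        = flat (m + 2) t - real m * flat (Suc m) t"
      using greater by (cases m) (simp_all add: flat_def)
    ultimately show ?thesis by metis
  qed
  moreover have "\<forall>\<^sub>F s in nhds t. inverse s ^ m * exp (- inverse s) = flat m s"
    using eventually_nhds_in_open[of "{0<..}" t] greater
    by (auto simp: flat_def elim!: eventually_mono)
  ultimately show ?thesis
    using DERIV_cong_ev[of t t "\<lambda>t. inverse t ^ m * exp (- inverse t)" "flat m"] by simp
qed

text \<open>
  Composing with a function of one real variable only needs the one-dimensional chain rule
  in each coordinate direction, which suits the definition by partial derivatives. The index
  \<open>m\<close> has to be generalized, since differentiating raises it.
\<close>

lemma Ck_on_flat:
  assumes "openin (Euclidean_space n) S" "\<And>k. Ck_on n k S f"
  shows "Ck_on n k S (\<lambda>z. flat m (f z))"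
proof (induction k arbitrary: m)
  case 0
  have "continuous_on UNIV (flat m)"
    using DERIV_flat DERIV_isCont continuous_at_imp_continuous_on by blast
  then show ?case
    using assms(2)[of 0] continuous_on_compose2[of UNIV "flat m" S f] by simp
next
  case (Suc k)
  let ?D = "\<lambda>i z. (flat (m + 2) (f z) + - real m * flat (Suc m) (f z)) * partial i f z"
  have p: "has_partial i (\<lambda>z. flat m (f z)) z" "partial i (\<lambda>z. flat m (f z)) z = ?D i z"
    if "i < n" "z \<in> S" for i z
  proof -
    have "has_partial i f z" using assms(2)[of "Suc 0"] that by simp
    then have "((\<lambda>t. flat m (f (z(i := t)))) has_real_derivative ?D i z) (at (z i))"
      using DERIV_chain2[of "flat m" _ "\<lambda>t. f (z(i := t))" "z i",
          OF DERIV_flat has_partial_imp_DERIV] by simp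
    then show "has_partial i (\<lambda>z. flat m (f z)) z" "partial i (\<lambda>z. flat m (f z)) z = ?D i z"
      by (rule DERIV_imp_partial)+
  qed
  have "Ck_on n k S (partial i (\<lambda>z. flat m (f z)))" if "i < n" for i
  proof (rule Ck_on_cong[where f = "?D i"])
    show "Ck_on n k S (?D i)"
      using assms(2)[of "Suc k"] that
      by (intro Ck_on_mult[OF assms(1)] Ck_on_add[OF assms(1)] Suc.IH Ck_on_const) simp
  qed (use that p assms(1) in auto)
  then show ?case
    using p Suc.IH[THEN Ck_on_continuous] by auto
qed


section \<open>Smooth functions on a manifold\<close>

lemma chart:
  assumes "smooth_manifold M" "(U, \<phi>) \<in> atlas M"
  shows chart_open: "open U"
    and chart_image_openin: "openin (Euclidean_space (mdim M)) (\<phi> ` U)"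
    and chart_homeomorphic_map:
      "homeomorphic_map (top_of_set U) (subtopology (Euclidean_space (mdim M)) (\<phi> ` U)) \<phi>"
  using assms unfolding smooth_manifold_def by blast+

lemma chart_inj_on:
  assumes "smooth_manifold M" "(U, \<phi>) \<in> atlas M"
  shows "inj_on \<phi> U"
  using homeomorphic_imp_injective_map[OF chart_homeomorphic_map[OF assms]] by simp

lemma ex_chart_at:
  assumes "smooth_manifold M"
  obtains U \<phi> where "(U, \<phi>) \<in> atlas M" "x \<in> U"
proof -
  have "x \<in> (\<Union>(U, \<phi>)\<in>atlas M. U)"
    using assms unfolding smooth_manifold_def by blast
  then show thesis using that by blast
qed

lemma chart_image_openin_Int:
  assumes "smooth_manifold M" "(U, \<phi>) \<in> atlas M" "open W"
  shows "openin (Euclidean_space (mdim M)) (\<phi> ` (U \<inter> W))"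
proof -
  have "openin (subtopology (Euclidean_space (mdim M)) (\<phi> ` U)) (\<phi> ` (U \<inter> W))"
    using homeomorphic_imp_open_map[OF chart_homeomorphic_map[OF assms(1,2)]] assms(3)
    unfolding open_map_def by (simp add: openin_open_Int)
  then show ?thesis
    using openin_trans_full chart_image_openin[OF assms(1,2)] by blast
qed

lemma smooth_on_cong:
  assumes M: "smooth_manifold M" "open W" and f: "smooth_on M W f"
    and eq: "\<And>x. x \<in> W \<Longrightarrow> f x = h x"
  shows "smooth_on M W h"
  unfolding smooth_on_def Cinf_on_def
proof clarify
  fix U \<phi> k assume U: "(U, \<phi>) \<in> atlas M"
  show "Ck_on (mdim M) k (\<phi> ` (U \<inter> W)) (\<lambda>z. h (inv_into U \<phi> z))"
  proof (rule Ck_on_cong[OF _ chart_image_openin_Int[OF M(1) U M(2)]])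
    show "Ck_on (mdim M) k (\<phi> ` (U \<inter> W)) (\<lambda>z. f (inv_into U \<phi> z))"
      using f U unfolding smooth_on_def Cinf_on_def by blast
  qed (use eq chart_inj_on[OF M(1) U] in auto)
qed

lemma smooth_on_subset:
  assumes "smooth_on M W f" "N \<subseteq> W"
  shows "smooth_on M N f"
  unfolding smooth_on_def Cinf_on_def
proof clarify
  fix U \<phi> k assume "(U, \<phi>) \<in> atlas M"
  then have "Ck_on (mdim M) k (\<phi> ` (U \<inter> W)) (\<lambda>z. f (inv_into U \<phi> z))"
    using assms(1) unfolding smooth_on_def Cinf_on_def by blast
  then show "Ck_on (mdim M) k (\<phi> ` (U \<inter> N)) (\<lambda>z. f (inv_into U \<phi> z))"
    by (rule Ck_on_subset) (use assms(2) in auto)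
qed

lemma smooth_on_locally:
  assumes M: "smooth_manifold M" and W: "open W"
    and f: "\<And>x. x \<in> W \<Longrightarrow> \<exists>N. open N \<and> x \<in> N \<and> smooth_on M (N \<inter> W) f"
  shows "smooth_on M W f"
  unfolding smooth_on_def Cinf_on_def
proof clarify
  fix U \<phi> k assume U: "(U, \<phi>) \<in> atlas M"
  show "Ck_on (mdim M) k (\<phi> ` (U \<inter> W)) (\<lambda>z. f (inv_into U \<phi> z))"
  proof (rule Ck_on_locally)
    show "\<phi> ` (U \<inter> W) \<subseteq> topspace (Euclidean_space (mdim M))"
      using chart_image_openin_Int[OF M U W] by (rule openin_subset)
    fix z assume "z \<in> \<phi> ` (U \<inter> W)"
    then obtain x where x: "x \<in> U" "x \<in> W" "z = \<phi> x" by blast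
    obtain N where N: "open N" "x \<in> N" "smooth_on M (N \<inter> W) f"
      using f x(2) by meson
    have "openin (Euclidean_space (mdim M)) (\<phi> ` (U \<inter> (N \<inter> W)))"
      using chart_image_openin_Int[OF M U] N(1) W by blast
    moreover have "Ck_on (mdim M) k (\<phi> ` (U \<inter> (N \<inter> W))) (\<lambda>z. f (inv_into U \<phi> z))"
      using N(3) U unfolding smooth_on_def Cinf_on_def by blast
    ultimately show "\<exists>T. openin (Euclidean_space (mdim M)) T \<and> z \<in> T \<and> T \<subseteq> \<phi> ` (U \<inter> W) \<and>
        Ck_on (mdim M) k T (\<lambda>z. f (inv_into U \<phi> z))"
      using x N(2) by (intro exI[of _ "\<phi> ` (U \<inter> (N \<inter> W))"]) auto
  qed
qed

lemma smooth_on_const: "smooth_on M W (\<lambda>x. c)"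
  unfolding smooth_on_def Cinf_on_def by (simp add: Ck_on_const split_beta)

lemma smooth_on_add:
  assumes "smooth_manifold M" "open W" "smooth_on M W f" "smooth_on M W h"
  shows "smooth_on M W (\<lambda>x. f x + h x)"
  unfolding smooth_on_def Cinf_on_def
proof clarify
  fix U \<phi> k assume U: "(U, \<phi>) \<in> atlas M"
  show "Ck_on (mdim M) k (\<phi> ` (U \<inter> W)) (\<lambda>z. f (inv_into U \<phi> z) + h (inv_into U \<phi> z))"
    using assms(3,4) U unfolding smooth_on_def Cinf_on_def
    by (intro Ck_on_add chart_image_openin_Int[OF assms(1) U assms(2)]) blast+
qed

lemma smooth_on_mult:
  assumes "smooth_manifold M" "open W" "smooth_on M W f" "smooth_on M W h"
  shows "smooth_on M W (\<lambda>x. f x * h x)"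
  unfolding smooth_on_def Cinf_on_def
proof clarify
  fix U \<phi> k assume U: "(U, \<phi>) \<in> atlas M"
  show "Ck_on (mdim M) k (\<phi> ` (U \<inter> W)) (\<lambda>z. f (inv_into U \<phi> z) * h (inv_into U \<phi> z))"
    using assms(3,4) U unfolding smooth_on_def Cinf_on_def
    by (intro Ck_on_mult chart_image_openin_Int[OF assms(1) U assms(2)]) blast+
qed

lemma smooth_on_flat:
  assumes "smooth_manifold M" "open W" "smooth_on M W f"
  shows "smooth_on M W (\<lambda>x. flat m (f x))"
  unfolding smooth_on_def Cinf_on_def
proof clarify
  fix U \<phi> k assume U: "(U, \<phi>) \<in> atlas M"
  show "Ck_on (mdim M) k (\<phi> ` (U \<inter> W)) (\<lambda>z. flat m (f (inv_into U \<phi> z)))"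
    using assms(3) U unfolding smooth_on_def Cinf_on_def
    by (intro Ck_on_flat chart_image_openin_Int[OF assms(1) U assms(2)]) blast
qed

lemma smooth_on_sum:
  assumes "smooth_manifold M" "open W" "finite I" "\<And>i. i \<in> I \<Longrightarrow> smooth_on M W (f i)"
  shows "smooth_on M W (\<lambda>x. \<Sum>i\<in>I. f i x)"
  using assms(3,4)
  by (induction I rule: finite_induct)
    (auto intro!: smooth_on_add[OF assms(1,2)] smooth_on_const)

lemma smooth_on_chart_coord:
  assumes "smooth_manifold M" "(U, \<phi>) \<in> atlas M" "i < mdim M"
  shows "smooth_on M U (\<lambda>x. \<phi> x i)"
  using assms unfolding smooth_manifold_def smooth_on_def by blast


section \<open>Bump functions\<close>

text \<open>
  A basic open set of the product topology restricts each coordinate separately, and only the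
  first \<open>n\<close> coordinates need a positive radius; Tychonoff's theorem gives compactness.
\<close>

lemma Euclidean_space_compact_cube:
  assumes S: "openin (Euclidean_space n) S" and a: "a \<in> S"
  obtains r where "r > 0"
    "compact {z \<in> topspace (Euclidean_space n). \<forall>i<n. \<bar>z i - a i\<bar> \<le> r}"
    "{z \<in> topspace (Euclidean_space n). \<forall>i<n. \<bar>z i - a i\<bar> \<le> r} \<subseteq> S"
proof -
  obtain T where T: "open T" "S = T \<inter> topspace (Euclidean_space n)"
    using S by (rule openin_Euclidean_spaceE)
  have "openin (powertop_real UNIV) T"
    using T(1) by (simp add: euclidean_product_topology)
  from product_topology_open_contains_basis[OF this, of a] a T(2)
  obtain X where X: "a \<in> (\<Pi>\<^sub>E i\<in>UNIV. X i)" "\<And>i. open (X i)" "(\<Pi>\<^sub>E i\<in>UNIV. X i) \<subseteq> T"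
    by auto
  have "\<exists>r>0. cball (a i) r \<subseteq> X i" for i
    using X(1,2) open_contains_cball by (metis PiE_mem UNIV_I)
  then obtain r where r: "\<And>i. r i > 0" "\<And>i. cball (a i) (r i) \<subseteq> X i"
    by metis
  define q where "q = Min (insert 1 (r ` {..<n}))"
  have q: "q > 0" "\<And>i. i < n \<Longrightarrow> q \<le> r i"
    unfolding q_def using r(1) by auto
  let ?C = "{z \<in> topspace (Euclidean_space n). \<forall>i<n. \<bar>z i - a i\<bar> \<le> q}"
  have C: "?C = (\<Pi>\<^sub>E i\<in>UNIV. if i < n then cball (a i) q else {0})"
    by (auto simp: topspace_Euclidean_space PiE_iff dist_real_def abs_minus_commute
        split: if_splits)
  have "compactin (powertop_real UNIV) ?C"
    unfolding C by (auto simp: compactin_PiE)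
  then have "compact ?C"
    by (simp add: euclidean_product_topology)
  moreover have "?C \<subseteq> S"
  proof
    fix z assume z: "z \<in> ?C"
    have "z i \<in> X i" for i
    proof (cases "i < n")
      case True
      then have "z i \<in> cball (a i) (r i)"
        using z q(2)[of i] by (auto simp: dist_real_def abs_minus_commute)
      then show ?thesis using r(2) by blast
    next
      case False
      then have "z i = a i"
        using z a T(2) by (auto simp: topspace_Euclidean_space)
      then show ?thesis using X(1) by auto
    qed
    then show "z \<in> S"
      using X(3) z T(2) by (auto simp: PiE_iff)
  qed
  ultimately show thesis
    using that q(1) by blast
qed

text \<open>
  In a chart around \<open>x\<close>, compose \<open>flat 0\<close> with \<open>r\<^sup>2\<close> minus the squared distance from \<open>x\<close>. The
  result vanishes outside the preimage \<open>K\<close> of a compact cube; \<open>K\<close> is compact, hence closed as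
  \<open>M\<close> is Hausdorff, and so the extension by zero is smooth on the open complement of \<open>K\<close> as
  well. Since the bump function depends on the coordinates only through sums, products and
  \<open>flat\<close>, smoothness in every other chart follows from smoothness of the transition functions.
\<close>

lemma ex_bump_function:
  fixes M :: "'m::{t2_space,second_countable_topology} manifold"
  assumes M: "smooth_manifold M" and N: "open N" "x \<in> N"
  obtains b K where "b \<in> smooth_functions M" "b x = 1" "closed K" "K \<subseteq> N"
    "\<And>y. y \<notin> K \<Longrightarrow> b y = 0"
proof -
  obtain U \<phi> where U: "(U, \<phi>) \<in> atlas M" "x \<in> U"
    using ex_chart_at[OF M] .
  let ?n = "mdim M" and ?a = "\<phi> x"
  let ?cube = "\<lambda>r. {z \<in> topspace (Euclidean_space ?n). \<forall>i<?n. \<bar>z i - ?a i\<bar> \<le> r}"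
  obtain r where r: "r > 0" and C: "compact (?cube r)" and CU: "?cube r \<subseteq> \<phi> ` (U \<inter> N)"
    using Euclidean_space_compact_cube[OF chart_image_openin_Int[OF M U(1) N(1)], of ?a] U(2) N(2)
    by blast
  let ?C = "?cube r"
  obtain h where h: "homeomorphic_maps (top_of_set U)
      (subtopology (Euclidean_space ?n) (\<phi> ` U)) \<phi> h"
    using chart_homeomorphic_map[OF M U(1)] homeomorphic_map_maps by blast
  have h\<phi>: "h (\<phi> y) = y" if "y \<in> U" for y
    using h that unfolding homeomorphic_maps_def by simp
  have "continuous_map (subtopology (Euclidean_space ?n) (\<phi> ` U)) euclidean h"
    using h unfolding homeomorphic_maps_def continuous_map_in_subtopology by blast
  moreover have "compactin (subtopology (Euclidean_space ?n) (\<phi> ` U)) ?C"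
    using C CU unfolding Euclidean_space_def compactin_subtopology euclidean_product_topology
    by (auto simp: topspace_Euclidean_space)
  ultimately have "compact (h ` ?C)"
    using image_compactin by force
  then have K: "closed (h ` ?C)"
    by (rule compact_imp_closed)
  have KN: "h ` ?C \<subseteq> U \<inter> N"
    using CU h\<phi> by auto
  define \<beta> where "\<beta> y = (if y \<in> U then flat 0 (r\<^sup>2 + - 1 * (\<Sum>i<?n. (\<phi> y i + - ?a i) * (\<phi> y i + - ?a i))) else 0)"
    for y
  have \<beta>x: "\<beta> x > 0"
    using U(2) r by (simp add: \<beta>_def flat_pos)
  have \<beta>0: "\<beta> y = 0" if y: "y \<notin> h ` ?C" for y
  proof (rule ccontr)
    assume "\<beta> y \<noteq> 0"
    then have yU: "y \<in> U" and *: "(\<Sum>i<?n. (\<phi> y i - ?a i)\<^sup>2) < r\<^sup>2"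
      by (auto simp: \<beta>_def flat_def power2_eq_square split: if_splits)
    have "\<bar>\<phi> y i - ?a i\<bar> \<le> r" if "i < ?n" for i
    proof -
      have "(\<phi> y i - ?a i)\<^sup>2 \<le> (\<Sum>i<?n. (\<phi> y i - ?a i)\<^sup>2)"
        using that by (intro member_le_sum) auto
      with * have "\<bar>\<phi> y i - ?a i\<bar>\<^sup>2 \<le> r\<^sup>2" by simp
      then show ?thesis using r power2_le_imp_le by (meson less_imp_le)
    qed
    moreover have "\<phi> y \<in> topspace (Euclidean_space ?n)"
      using openin_subset[OF chart_image_openin[OF M U(1)]] yU by blast
    ultimately have "\<phi> y \<in> ?C" by blast
    then show False
      using y h\<phi>[OF yU] by (metis (no_types, lifting) image_eqI)
  qed
  \<comment> \<open>\<open>U\<close> and the complement of \<open>K\<close> cover \<open>M\<close>.\<close>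
  have "smooth_on M UNIV \<beta>"
  proof (rule smooth_on_locally[OF M open_UNIV])
    fix y
    show "\<exists>N'. open N' \<and> y \<in> N' \<and> smooth_on M (N' \<inter> UNIV) \<beta>"
    proof (cases "y \<in> U")
      case True
      have "smooth_on M U (\<lambda>y. flat 0 (r\<^sup>2 + - 1 * (\<Sum>i<?n. (\<phi> y i + - ?a i) * (\<phi> y i + - ?a i))))"
        using chart_open[OF M U(1)]
        by (intro smooth_on_flat smooth_on_add smooth_on_mult smooth_on_sum smooth_on_const
            smooth_on_chart_coord[OF M U(1)] M) auto
      then have "smooth_on M U \<beta>"
        by (rule smooth_on_cong[OF M chart_open[OF M U(1)]]) (simp add: \<beta>_def)
      then show ?thesis
        using True chart_open[OF M U(1)] by auto
    next
      case False
      then have "y \<in> - h ` ?C"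
        using KN by blast
      moreover have "smooth_on M (- h ` ?C) \<beta>"
        by (rule smooth_on_cong[OF M _ smooth_on_const[of _ _ 0]]) (use K \<beta>0 in auto)
      ultimately show ?thesis
        using K by (intro exI[of _ "- h ` ?C"]) auto
    qed
  qed
  then have "(\<lambda>y. inverse (\<beta> x) * \<beta> y) \<in> smooth_functions M"
    unfolding smooth_functions_def
    by (auto intro: smooth_on_mult[OF M open_UNIV smooth_on_const])
  then show thesis
    using that[of "\<lambda>y. inverse (\<beta> x) * \<beta> y" "h ` ?C"] \<beta>x \<beta>0 K KN by auto
qed


section \<open>Linear maps on subspaces\<close>

lemma lin_on_add: "lin_on V f \<Longrightarrow> u \<in> V \<Longrightarrow> v \<in> V \<Longrightarrow> f (u + v) = f u + f v"
  and lin_on_scaleR: "lin_on V f \<Longrightarrow> u \<in> V \<Longrightarrow> f (c *\<^sub>R u) = c *\<^sub>R f u"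
  unfolding lin_on_def by blast+

lemma lin_on_zero: "lin_on V f \<Longrightarrow> 0 \<in> V \<Longrightarrow> f 0 = 0"
  using lin_on_scaleR[of V f 0 0] by simp

lemma lin_on_diff:
  assumes "lin_on V f" "subspace V" "u \<in> V" "v \<in> V"
  shows "f (u - v) = f u - f v"
proof -
  have "f (u + - 1 *\<^sub>R v) = f u + - 1 *\<^sub>R f v"
    using assms by (simp only: lin_on_add lin_on_scaleR subspace_scale)
  then show ?thesis by simp
qed

lemma lin_on_compose:
  "lin_on V f \<Longrightarrow> f ` V \<subseteq> W \<Longrightarrow> lin_on W h \<Longrightarrow> lin_on V (\<lambda>v. h (f v))"
  unfolding lin_on_def by (auto simp: image_subset_iff)

lemma lin_on_apply: "lin_on V f \<Longrightarrow> lin_on V (\<lambda>v. f v i)"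
  unfolding lin_on_def by (auto simp: scaleR_fun_def)

lemma lin_on_subset: "lin_on V f \<Longrightarrow> W \<subseteq> V \<Longrightarrow> lin_on W f"
  unfolding lin_on_def by blast


section \<open>Sections of vector bundles\<close>

lemma vector_bundle_subspace: "vector_bundle M E \<Longrightarrow> subspace (fibre E x)"
  unfolding vector_bundle_def by blast

lemma triv:
  assumes "vector_bundle M E" "(U, \<Phi>) \<in> trivs E"
  shows triv_open: "open U"
    and triv_lin_on: "x \<in> U \<Longrightarrow> lin_on (fibre E x) (\<Phi> x)"
    and triv_bij_betw:
      "x \<in> U \<Longrightarrow> bij_betw (\<Phi> x) (fibre E x) (topspace (Euclidean_space (vrank E)))"
  using assms unfolding vector_bundle_def by blast+

lemma ex_triv_at:
  assumes "vector_bundle M E"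
  obtains U \<Phi> where "(U, \<Phi>) \<in> trivs E" "x \<in> U"
proof -
  have "x \<in> (\<Union>(U, \<Phi>)\<in>trivs E. U)"
    using assms unfolding vector_bundle_def by blast
  then show thesis using that by blast
qed

lemma frame:
  assumes "vector_bundle M E" "(U, \<Phi>) \<in> trivs E" "x \<in> U" "j < vrank E"
  shows frame_in_fibre: "frame E \<Phi> j x \<in> fibre E x"
    and triv_frame: "\<Phi> x (frame E \<Phi> j x) = (\<lambda>i. if i = j then 1 else 0)"
proof -
  have *: "(\<lambda>i. if i = j then 1 else 0) \<in> \<Phi> x ` fibre E x"
    using triv_bij_betw[OF assms(1-3)] assms(4)
    by (auto simp: bij_betw_def topspace_Euclidean_space)
  show "frame E \<Phi> j x \<in> fibre E x" "\<Phi> x (frame E \<Phi> j x) = (\<lambda>i. if i = j then 1 else 0)"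
    unfolding frame_def using * by (rule inv_into_into, rule f_inv_into_f)
qed

lemma sum_fun_apply: "(\<Sum>j\<in>J. f j) x = (\<Sum>j\<in>J. f j x)"
  by (induction J rule: infinite_finite_induct) auto

text \<open>
  Both sides have the same image under the trivialization, which is injective on the fibre.
\<close>

lemma frame_expansion:
  assumes "vector_bundle M E" "(U, \<Phi>) \<in> trivs E" "x \<in> U" "e \<in> fibre E x"
  shows "e = (\<Sum>j<vrank E. \<Phi> x e j *\<^sub>R frame E \<Phi> j x)"
proof -
  let ?e = "\<Sum>j<vrank E. \<Phi> x e j *\<^sub>R frame E \<Phi> j x"
  have fr: "frame E \<Phi> j x \<in> fibre E x" if "j \<in> {..<vrank E}" for j
    using frame_in_fibre[OF assms(1-3)] that by simp
  have mem: "?e \<in> fibre E x"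
    using fr vector_bundle_subspace[OF assms(1)] by (auto intro!: subspace_sum subspace_scale)
  have "\<Phi> x ?e = (\<Sum>j<vrank E. \<Phi> x e j *\<^sub>R \<Phi> x (frame E \<Phi> j x))"
    by (rule lin_on_sum[OF triv_lin_on[OF assms(1-3)] vector_bundle_subspace[OF assms(1)] _ fr]) auto
  also have "\<dots> = \<Phi> x e"
  proof
    fix i
    have "\<Phi> x e i = 0" if "\<not> i < vrank E"
      using bij_betwE[OF triv_bij_betw[OF assms(1-3)]] assms(4) that
      by (auto simp: topspace_Euclidean_space)
    then show "(\<Sum>j<vrank E. \<Phi> x e j *\<^sub>R \<Phi> x (frame E \<Phi> j x)) i = \<Phi> x e i"
      by (simp add: sum_fun_apply scaleR_fun_def triv_frame[OF assms(1-3)] if_distrib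
          sum.delta' cong: if_cong)
  qed
  finally show ?thesis
    using triv_bij_betw[OF assms(1-3)] mem assms(4) unfolding bij_betw_def inj_on_def by auto
qed

lemma lin_on_frame_expansion:
  assumes "vector_bundle M E" "(U, \<Phi>) \<in> trivs E" "x \<in> U" "e \<in> fibre E x" "lin_on (fibre E x) f"
  shows "f e = (\<Sum>j<vrank E. \<Phi> x e j *\<^sub>R f (frame E \<Phi> j x))"
proof -
  have "f e = f (\<Sum>j<vrank E. \<Phi> x e j *\<^sub>R frame E \<Phi> j x)"
    using frame_expansion[OF assms(1-4)] by simp
  also have "\<dots> = (\<Sum>j<vrank E. \<Phi> x e j *\<^sub>R f (frame E \<Phi> j x))"
    by (rule lin_on_sum[OF assms(5) vector_bundle_subspace[OF assms(1)]])
      (auto intro: frame_in_fibre[OF assms(1-3)])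
  finally show ?thesis .
qed

lemma sections_in_fibre: "s \<in> sections M E \<Longrightarrow> s x \<in> fibre E x"
  unfolding sections_def by blast

lemma smooth_on_section_coord:
  "s \<in> sections M E \<Longrightarrow> (U, \<Phi>) \<in> trivs E \<Longrightarrow> i < vrank E \<Longrightarrow>
   smooth_on M U (\<lambda>x. \<Phi> x (s x) i)"
  unfolding sections_def by blast

lemma subspace_sections:
  assumes M: "smooth_manifold M" and E: "vector_bundle M E"
  shows "subspace (sections M E)"
proof (rule subspaceI)
  have "smooth_on M U (\<lambda>x. \<Phi> x (0 x) i)" if "(U, \<Phi>) \<in> trivs E" "i < vrank E" for U \<Phi> i
    by (rule smooth_on_cong[OF M triv_open[OF E that(1)] smooth_on_const[of _ _ 0]])
      (simp add: lin_on_zero[OF triv_lin_on[OF E that(1)]] subspace_0 vector_bundle_subspace[OF E])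
  then show "0 \<in> sections M E"
    unfolding sections_def by (auto simp: subspace_0 vector_bundle_subspace[OF E])
next
  fix s t assume st: "s \<in> sections M E" "t \<in> sections M E"
  have "smooth_on M U (\<lambda>x. \<Phi> x ((s + t) x) i)" if U: "(U, \<Phi>) \<in> trivs E" "i < vrank E" for U \<Phi> i
    by (rule smooth_on_cong[OF M triv_open[OF E U(1)]
          smooth_on_add[OF M triv_open[OF E U(1)] st[THEN smooth_on_section_coord, OF U]]])
      (simp add: lin_on_add[OF triv_lin_on[OF E U(1)]] st[THEN sections_in_fibre])
  then show "s + t \<in> sections M E"
    unfolding sections_def
    by (auto intro!: subspace_add vector_bundle_subspace[OF E] st[THEN sections_in_fibre])
next
  fix c s assume s: "s \<in> sections M E"
  have "smooth_on M U (\<lambda>x. \<Phi> x ((c *\<^sub>R s) x) i)" if U: "(U, \<Phi>) \<in> trivs E" "i < vrank E" for U \<Phi> i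
    by (rule smooth_on_cong[OF M triv_open[OF E U(1)] smooth_on_mult[OF M triv_open[OF E U(1)]
            smooth_on_const[of _ _ c] smooth_on_section_coord[OF s U]]])
      (simp add: scaleR_fun_def lin_on_scaleR[OF triv_lin_on[OF E U(1)]] sections_in_fibre[OF s])
  then show "c *\<^sub>R s \<in> sections M E"
    unfolding sections_def
    by (auto intro!: subspace_scale vector_bundle_subspace[OF E] sections_in_fibre[OF s]
        simp: scaleR_fun_def)
qed

text \<open>
  The vector is extended with constant coefficients in a local frame and then cut off by a
  bump function.
\<close>

lemma ex_section_through:
  fixes M :: "'m::{t2_space,second_countable_topology} manifold"
  assumes M: "smooth_manifold M" and E: "vector_bundle M E" and e: "e \<in> fibre E x"
  obtains s where "s \<in> sections M E" "s x = e"
proof -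
  obtain U \<Phi> where U: "(U, \<Phi>) \<in> trivs E" "x \<in> U"
    using ex_triv_at[OF E] .
  obtain b K where b: "b \<in> smooth_functions M" "b x = 1" "closed K" "K \<subseteq> U"
    "\<And>y. y \<notin> K \<Longrightarrow> b y = 0"
    using ex_bump_function[OF M triv_open[OF E U(1)] U(2)] by blast
  define t where "t y = (\<Sum>j<vrank E. \<Phi> x e j *\<^sub>R frame E \<Phi> j y)" for y
  define s where "s y = (if y \<in> U then b y *\<^sub>R t y else 0)" for y
  have fr: "frame E \<Phi> j y \<in> fibre E y" if "y \<in> U" "j \<in> {..<vrank E}" for j y
    using frame_in_fibre[OF E U(1)] that by simp
  have t: "t y \<in> fibre E y" if "y \<in> U" for y
    unfolding t_def using fr[OF that] vector_bundle_subspace[OF E]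
    by (auto intro!: subspace_sum subspace_scale)
  have s0: "s y = 0" if "y \<in> - K" for y
    using that b by (simp add: s_def)
  have "s y \<in> fibre E y" for y
    unfolding s_def using t vector_bundle_subspace[OF E] by (auto intro: subspace_scale subspace_0)
  moreover have "smooth_on M V (\<lambda>y. \<Psi> y (s y) i)" if V: "(V, \<Psi>) \<in> trivs E" and i: "i < vrank E"
    for V \<Psi> i
  proof (rule smooth_on_locally[OF M triv_open[OF E V]])
    fix y assume y: "y \<in> V"
    show "\<exists>N. open N \<and> y \<in> N \<and> smooth_on M (N \<inter> V) (\<lambda>y. \<Psi> y (s y) i)"
    proof (cases "y \<in> U")
      case True
      have UV: "open (U \<inter> V)"
        using triv_open[OF E] U(1) V by blast
      have "smooth_on M (U \<inter> V) b"
        using b(1) smooth_on_subset unfolding smooth_functions_def by blast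
      moreover have "smooth_on M (U \<inter> V) (\<lambda>x. \<Psi> x (frame E \<Phi> j x) i)" if "j < vrank E" for j
        using E U(1) V i that unfolding vector_bundle_def by blast
      ultimately have "smooth_on M (U \<inter> V)
          (\<lambda>y. b y * (\<Sum>j<vrank E. \<Phi> x e j * \<Psi> y (frame E \<Phi> j y) i))"
        by (intro smooth_on_mult smooth_on_sum smooth_on_const M UV) auto
      then have "smooth_on M (U \<inter> V) (\<lambda>y. \<Psi> y (s y) i)"
      proof (rule smooth_on_cong[OF M UV])
        fix y assume y: "y \<in> U \<inter> V"
        have lin: "lin_on (fibre E y) (\<lambda>e. \<Psi> y e i)"
          using triv_lin_on[OF E V] y by (auto intro: lin_on_apply)
        have "\<Psi> y (t y) i = (\<Sum>j<vrank E. \<Phi> x e j *\<^sub>R \<Psi> y (frame E \<Phi> j y) i)"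
          unfolding t_def
          by (rule lin_on_sum[OF lin vector_bundle_subspace[OF E]]) (use fr y in auto)
        then show "b y * (\<Sum>j<vrank E. \<Phi> x e j * \<Psi> y (frame E \<Phi> j y) i) = \<Psi> y (s y) i"
          using y lin_on_scaleR[OF lin t] by (simp add: s_def)
      qed
      then show ?thesis
        using True triv_open[OF E U(1)] by blast
    next
      case False
      have "smooth_on M (- K \<inter> V) (\<lambda>y. \<Psi> y (s y) i)"
        by (rule smooth_on_cong[OF M _ smooth_on_const[of _ _ 0]])
          (use b(3) triv_open[OF E V] s0 lin_on_zero[OF triv_lin_on[OF E V]]
            subspace_0[OF vector_bundle_subspace[OF E]] in auto)
      then show ?thesis
        using False b(3,4) by (intro exI[of _ "- K"]) auto
    qed
  qed
  ultimately have "s \<in> sections M E"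
    unfolding sections_def by blast
  moreover have "s x = e"
    using U(2) b(2) frame_expansion[OF E U e] by (simp add: s_def t_def)
  ultimately show thesis by (rule that)
qed

text \<open>
  The pairing with sections determines a section, because every vector of a fibre is the value
  of a global section.
\<close>

lemma fibre_metric_zeroI:
  fixes M :: "'m::{t2_space,second_countable_topology} manifold"
  assumes M: "smooth_manifold M" and E: "vector_bundle M E" and g: "fibre_metric M E g"
    and s: "s \<in> sections M E" and z: "\<And>\<eta>. \<eta> \<in> sections M E \<Longrightarrow> pairing g s \<eta> = 0"
  shows "s = 0"
proof
  fix x
  have "g x (s x) e = 0" if e: "e \<in> fibre E x" for e
  proof -
    obtain \<eta> where \<eta>: "\<eta> \<in> sections M E" "\<eta> x = e"
      by (rule ex_section_through[OF M E e])
    then show ?thesis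
      using fun_cong[OF z[OF \<eta>(1)], of x] by (simp add: pairing_def)
  qed
  then show "s x = 0 x"
    using g sections_in_fibre[OF s, of x] unfolding fibre_metric_def zero_fun_def by blast
qed


section \<open>Bundle maps\<close>

lemma bundle_map_image: "bundle_map M A B F \<Longrightarrow> F x ` fibre A x \<subseteq> fibre B x"
  and bundle_map_lin_on: "bundle_map M A B F \<Longrightarrow> lin_on (fibre A x) (F x)"
  unfolding bundle_map_def by simp_all

lemma bundle_map_in_fibre: "bundle_map M A B F \<Longrightarrow> e \<in> fibre A x \<Longrightarrow> F x e \<in> fibre B x"
  using bundle_map_image[of M A B F x] by auto

lemma bundle_map_smooth:
  assumes "bundle_map M A B F" "(U, \<Phi>) \<in> trivs A" "(V, \<Psi>) \<in> trivs B" "i < vrank B" "j < vrank A"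
  shows "smooth_on M (U \<inter> V) (\<lambda>x. \<Psi> x (F x (frame A \<Phi> j x)) i)"
proof -
  have "\<forall>(U, \<Phi>)\<in>trivs A. \<forall>(V, \<Psi>)\<in>trivs B. \<forall>i<vrank B. \<forall>j<vrank A.
       smooth_on M (U \<inter> V) (\<lambda>x. \<Psi> x (F x (frame A \<Phi> j x)) i)"
    using assms(1) unfolding bundle_map_def by (rule conjunct2)
  then show ?thesis
    using assms(2-5) by fast
qed

text \<open>
  Locally, the matrix of the composition is the product of the matrices, expanded in a frame of
  the bundle in the middle. The target is described by two properties of its trivializations
  because these are immediate for the tangent bundle (\<open>tangent_bundle_triv_lin_on\<close>).
\<close>

lemma bundle_map_comp:
  assumes M: "smooth_manifold M" and A: "vector_bundle M A" and B: "vector_bundle M B"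
    and F: "bundle_map M A B F" and G: "bundle_map M B C G"
    and C: "\<And>V \<Psi> x. (V, \<Psi>) \<in> trivs C \<Longrightarrow> x \<in> V \<Longrightarrow> open V \<and> lin_on (fibre C x) (\<Psi> x)"
  shows "bundle_map M A C (\<lambda>x e. G x (F x e))"
proof -
  have "smooth_on M (U \<inter> V) (\<lambda>x. \<Psi> x (G x (F x (frame A \<Phi> j x))) i)"
    if U: "(U, \<Phi>) \<in> trivs A" and V: "(V, \<Psi>) \<in> trivs C" and i: "i < vrank C" and j: "j < vrank A"
    for U \<Phi> V \<Psi> i j
  proof (rule smooth_on_locally[OF M])
    show UV: "open (U \<inter> V)"
      using triv_open[OF A U] C[OF V] by (cases "V = {}") auto
    fix x assume x: "x \<in> U \<inter> V"
    obtain W X where W: "(W, X) \<in> trivs B" "x \<in> W"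
      using ex_triv_at[OF B] .
    have WUV: "open (W \<inter> (U \<inter> V))"
      using triv_open[OF B W(1)] UV by blast
    have "smooth_on M (W \<inter> (U \<inter> V)) (\<lambda>x. X x (F x (frame A \<Phi> j x)) k)" if "k < vrank B" for k
      by (rule smooth_on_subset[OF bundle_map_smooth[OF F U W(1) that j]]) blast
    moreover have "smooth_on M (W \<inter> (U \<inter> V)) (\<lambda>x. \<Psi> x (G x (frame B X k x)) i)" if "k < vrank B" for k
      by (rule smooth_on_subset[OF bundle_map_smooth[OF G W(1) V i that]]) blast
    ultimately have "smooth_on M (W \<inter> (U \<inter> V))
        (\<lambda>x. \<Sum>k<vrank B. X x (F x (frame A \<Phi> j x)) k * \<Psi> x (G x (frame B X k x)) i)"
      by (intro smooth_on_mult smooth_on_sum M WUV) auto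
    then have "smooth_on M (W \<inter> (U \<inter> V)) (\<lambda>x. \<Psi> x (G x (F x (frame A \<Phi> j x))) i)"
    proof (rule smooth_on_cong[OF M WUV])
      fix y assume y: "y \<in> W \<inter> (U \<inter> V)"
      have "lin_on (fibre B y) (\<lambda>e. \<Psi> y (G y e) i)"
      proof (rule lin_on_compose[where h = "\<lambda>e. \<Psi> y e i"])
        show "lin_on (fibre B y) (G y)" "G y ` fibre B y \<subseteq> fibre C y"
          using bundle_map_lin_on[OF G] bundle_map_image[OF G] by simp_all
        show "lin_on (fibre C y) (\<lambda>e. \<Psi> y e i)"
          by (rule lin_on_apply) (use C[OF V] y in simp)
      qed
      moreover have "F y (frame A \<Phi> j y) \<in> fibre B y"
        by (rule bundle_map_in_fibre[OF F frame_in_fibre[OF A U _ j]]) (use y in simp)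
      ultimately show "(\<Sum>k<vrank B. X y (F y (frame A \<Phi> j y)) k * \<Psi> y (G y (frame B X k y)) i)
          = \<Psi> y (G y (F y (frame A \<Phi> j y))) i"
        using lin_on_frame_expansion[OF B W(1), of y "F y (frame A \<Phi> j y)" "\<lambda>e. \<Psi> y (G y e) i"] y
        by simp
    qed
    then show "\<exists>N. open N \<and> x \<in> N \<and>
        smooth_on M (N \<inter> (U \<inter> V)) (\<lambda>x. \<Psi> x (G x (F x (frame A \<Phi> j x))) i)"
      using W(2) triv_open[OF B W(1)] by blast
  qed
  moreover have "lin_on (fibre A x) (\<lambda>e. G x (F x e))" for x
    by (rule lin_on_compose[OF bundle_map_lin_on[OF F] bundle_map_image[OF F] bundle_map_lin_on[OF G]])
  moreover have "(\<lambda>e. G x (F x e)) ` fibre A x \<subseteq> fibre C x" for x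
    by (auto intro: bundle_map_in_fibre[OF F] bundle_map_in_fibre[OF G])
  ultimately show ?thesis
    unfolding bundle_map_def by (auto simp only: split_paired_all split_conv)
qed

lemma bundle_map_sections:
  assumes M: "smooth_manifold M" and A: "vector_bundle M A" and B: "vector_bundle M B"
    and F: "bundle_map M A B F" and s: "s \<in> sections M A"
  shows "(\<lambda>x. F x (s x)) \<in> sections M B"
proof -
  have "smooth_on M V (\<lambda>x. \<Psi> x (F x (s x)) i)" if V: "(V, \<Psi>) \<in> trivs B" and i: "i < vrank B"
    for V \<Psi> i
  proof (rule smooth_on_locally[OF M triv_open[OF B V]])
    fix x assume x: "x \<in> V"
    obtain U \<Phi> where U: "(U, \<Phi>) \<in> trivs A" "x \<in> U"
      using ex_triv_at[OF A] .
    have UV: "open (U \<inter> V)"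
      using triv_open[OF A U(1)] triv_open[OF B V] by blast
    have "smooth_on M (U \<inter> V) (\<lambda>x. \<Phi> x (s x) j)" if "j < vrank A" for j
      using smooth_on_subset[OF smooth_on_section_coord[OF s U(1) that]] by blast
    then have "smooth_on M (U \<inter> V)
        (\<lambda>x. \<Sum>j<vrank A. \<Phi> x (s x) j * \<Psi> x (F x (frame A \<Phi> j x)) i)"
      using bundle_map_smooth[OF F U(1) V i] by (intro smooth_on_mult smooth_on_sum M UV) auto
    then have "smooth_on M (U \<inter> V) (\<lambda>x. \<Psi> x (F x (s x)) i)"
    proof (rule smooth_on_cong[OF M UV])
      fix y assume y: "y \<in> U \<inter> V"
      then have "lin_on (fibre A y) (\<lambda>e. \<Psi> y (F y e) i)"
        using lin_on_compose[OF bundle_map_lin_on[OF F] bundle_map_image[OF F]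
            lin_on_apply[OF triv_lin_on[OF B V]]] by auto
      from lin_on_frame_expansion[OF A U(1) _ sections_in_fibre[OF s] this] y
      show "(\<Sum>j<vrank A. \<Phi> y (s y) j * \<Psi> y (F y (frame A \<Phi> j y)) i) = \<Psi> y (F y (s y)) i"
        by simp
    qed
    then show "\<exists>N. open N \<and> x \<in> N \<and> smooth_on M (N \<inter> V) (\<lambda>x. \<Psi> x (F x (s x)) i)"
      using U(2) triv_open[OF A U(1)] by blast
  qed
  then show ?thesis
    unfolding sections_def
    using bundle_map_in_fibre[OF F sections_in_fibre[OF s]] by blast
qed


section \<open>Alternating forms and the metric\<close>

lemma alternating_form_lin_on_slot:
  assumes "alternating_form V p \<alpha>" "set xs \<union> set ys \<subseteq> V" "Suc (length xs + length ys) = p"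
    and "u \<in> V"
  shows "lin_on V (\<lambda>e. \<alpha> (xs @ e # ys))"
proof -
  have "lin_on V (\<lambda>e. \<alpha> ((xs @ u # ys)[length xs := e]))"
  proof -
    have "length (xs @ u # ys) = p \<and> set (xs @ u # ys) \<subseteq> V" "length xs < p"
      using assms by auto
    then show ?thesis
      using assms(1) unfolding alternating_form_def by blast
  qed
  then show ?thesis by simp
qed

text \<open>
  Polarization of the vanishing on repeated arguments.
\<close>

lemma alternating_form_swap:
  assumes \<alpha>: "alternating_form V p \<alpha>" and V: "subspace V"
    and s: "set xs \<union> set ys \<subseteq> V" "length xs + length ys + 2 = p" and uv: "u \<in> V" "v \<in> V"
  shows "\<alpha> (xs @ u # v # ys) = - \<alpha> (xs @ v # u # ys)"
proof -
  have lin1: "lin_on V (\<lambda>e. \<alpha> (xs @ e # w # ys))" if "w \<in> V" for w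
    using that s by (intro alternating_form_lin_on_slot[OF \<alpha>, of xs "w # ys" w]) auto
  have lin2: "lin_on V (\<lambda>e. \<alpha> (xs @ w # e # ys))" if "w \<in> V" for w
    using alternating_form_lin_on_slot[OF \<alpha>, of "xs @ [w]" ys w] that s by auto
  have z: "\<alpha> (xs @ w # w # ys) = 0" if "w \<in> V" for w
  proof -
    let ?es = "xs @ w # w # ys"
    have "length ?es = p \<and> set ?es \<subseteq> V" "length xs < Suc (length xs)" "Suc (length xs) < p"
      "?es ! length xs = ?es ! Suc (length xs)"
      using that s by (auto simp: nth_append)
    then show ?thesis
      using \<alpha> unfolding alternating_form_def by blast
  qed
  have w: "u + v \<in> V" using uv V by (rule_tac subspace_add)
  have "0 = \<alpha> (xs @ (u + v) # (u + v) # ys)" using z[OF w] by simp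
  also have "\<dots> = \<alpha> (xs @ u # (u + v) # ys) + \<alpha> (xs @ v # (u + v) # ys)"
    using lin1[OF w] uv unfolding lin_on_def by blast
  also have "\<alpha> (xs @ u # (u + v) # ys) = \<alpha> (xs @ u # u # ys) + \<alpha> (xs @ u # v # ys)"
    using lin2[OF uv(1)] uv unfolding lin_on_def by blast
  also have "\<alpha> (xs @ v # (u + v) # ys) = \<alpha> (xs @ v # u # ys) + \<alpha> (xs @ v # v # ys)"
    using lin2[OF uv(2)] uv unfolding lin_on_def by blast
  finally show ?thesis using z uv by simp
qed

lemma alternating_form_rotate:
  assumes \<alpha>: "alternating_form V p \<alpha>" and V: "subspace V"
    and "set xs \<union> set ys \<subseteq> V" "Suc (length xs + length ys) = p" "e \<in> V"
  shows "\<alpha> (xs @ e # ys) = (- 1) ^ length ys * \<alpha> (xs @ ys @ [e])"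
  using assms(3-)
proof (induction ys arbitrary: xs)
  case (Cons y ys)
  have "\<alpha> (xs @ e # y # ys) = - \<alpha> ((xs @ [y]) @ e # ys)"
    using alternating_form_swap[OF \<alpha> V, of xs ys e y] Cons.prems by auto
  also have "\<alpha> ((xs @ [y]) @ e # ys) = (- 1) ^ length ys * \<alpha> ((xs @ [y]) @ ys @ [e])"
    by (rule Cons.IH) (use Cons.prems in auto)
  finally show ?case by simp
qed simp

text \<open>
  The representing vector can be written down in a basis of the fibre that is orthonormal up to
  signs.
\<close>

lemma split_signature_representation:
  assumes g: "fibre_metric M E g" and ss: "split_signature E g"
    and \<theta>: "lin_on (fibre E x) \<theta>"
  obtains u where "u \<in> fibre E x" "\<And>v. v \<in> fibre E x \<Longrightarrow> g x u v = \<theta> v"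
proof -
  obtain n :: nat and e where sp: "span (e ` {..<2 * n}) = fibre E x"
    and ge: "\<And>i j. i < 2 * n \<Longrightarrow> j < 2 * n \<Longrightarrow>
      g x (e i) (e j) = (if i \<noteq> j then 0 else if i < n then 1 else - 1)"
    using ss unfolding split_signature_def by meson
  have V: "subspace (fibre E x)"
    unfolding sp[symmetric] by (rule subspace_span)
  have e: "e i \<in> fibre E x" if "i \<in> {..<2 * n}" for i
    unfolding sp[symmetric] using that by (auto intro: span_base)
  define c where "c i = (if i < n then 1 else - 1) * \<theta> (e i)" for i
  define u where "u = (\<Sum>i<2 * n. c i *\<^sub>R e i)"
  have u: "u \<in> fibre E x"
    unfolding u_def using e V by (auto intro!: subspace_sum subspace_scale)
  have gu: "lin_on (fibre E x) (g x u)"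
    using g u unfolding fibre_metric_def by blast
  have base: "g x u (e j) = \<theta> (e j)" if j: "j < 2 * n" for j
  proof -
    have "g x u (e j) = g x (e j) u"
      using g u e j unfolding fibre_metric_def by blast
    also have "\<dots> = (\<Sum>i<2 * n. c i *\<^sub>R g x (e j) (e i))"
      unfolding u_def
      by (rule lin_on_sum[OF _ V]) (use g e j in \<open>auto simp: fibre_metric_def\<close>)
    also have "\<dots> = (\<Sum>i<2 * n. if i = j then \<theta> (e j) else 0)"
      by (rule sum.cong) (auto simp: ge j c_def)
    also have "\<dots> = \<theta> (e j)" using j by simp
    finally show ?thesis .
  qed
  have "g x u v = \<theta> v" if "v \<in> fibre E x" for v
  proof -
    have "v \<in> fibre E x \<and> g x u v = \<theta> v"
      using that unfolding sp[symmetric]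
    proof (induction rule: span_induct)
      case base
      have "0 = g x u 0" "0 = \<theta> 0"
        using gu \<theta> subspace_0[OF V] unfolding lin_on_def by (metis scaleR_zero_left)+
      then show ?case
        using gu \<theta> V unfolding sp lin_on_def subspace_def by auto
    qed (use base e sp in auto)
    then show ?thesis ..
  qed
  with u show thesis by (rule that)
qed

lemma sharp_split_signature:
  assumes "fibre_metric M E g" "split_signature E g" "subspace (fibre E x)"
    "lin_on (fibre E x) \<theta>"
  shows sharp_in_fibre: "sharp E g x \<theta> \<in> fibre E x"
    and metric_sharp: "v \<in> fibre E x \<Longrightarrow> g x (sharp E g x \<theta>) v = \<theta> v"
proof -
  obtain u where u: "u \<in> fibre E x" "\<And>v. v \<in> fibre E x \<Longrightarrow> g x u v = \<theta> v"
    using split_signature_representation[OF assms(1,2,4)] by blast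
  have "sharp E g x \<theta> = u"
    by (rule sharp_eqI[OF assms(1,3) u])
  then show "sharp E g x \<theta> \<in> fibre E x" "v \<in> fibre E x \<Longrightarrow> g x (sharp E g x \<theta>) v = \<theta> v"
    using u by simp_all
qed

lemma sharp_combination:
  assumes g: "fibre_metric M E g" "split_signature E g" and V: "subspace (fibre E x)"
    and \<theta>: "lin_on (fibre E x) \<theta>\<^sub>1" "lin_on (fibre E x) \<theta>\<^sub>2"
    and eq: "\<And>v. v \<in> fibre E x \<Longrightarrow> \<theta> v = a * \<theta>\<^sub>1 v + b * \<theta>\<^sub>2 v"
  shows "sharp E g x \<theta> = a *\<^sub>R sharp E g x \<theta>\<^sub>1 + b *\<^sub>R sharp E g x \<theta>\<^sub>2"
proof (rule sharp_eqI[OF g(1) V])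
  let ?u = "sharp E g x \<theta>\<^sub>1" and ?w = "sharp E g x \<theta>\<^sub>2"
  have uw: "?u \<in> fibre E x" "?w \<in> fibre E x"
    using sharp_in_fibre[OF g V] \<theta> by blast+
  show mem: "a *\<^sub>R ?u + b *\<^sub>R ?w \<in> fibre E x"
    using uw V by (intro subspace_add subspace_scale)
  fix v assume v: "v \<in> fibre E x"
  have "g x (a *\<^sub>R ?u + b *\<^sub>R ?w) v = g x v (a *\<^sub>R ?u + b *\<^sub>R ?w)"
    using g(1) mem v unfolding fibre_metric_def by blast
  also have "\<dots> = a * g x v ?u + b * g x v ?w"
    using g(1) uw v V unfolding fibre_metric_def lin_on_def by (simp add: subspace_scale)
  also have "g x v ?u = \<theta>\<^sub>1 v"
    using g(1) uw v metric_sharp[OF g V \<theta>(1) v] unfolding fibre_metric_def by metis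
  also have "g x v ?w = \<theta>\<^sub>2 v"
    using g(1) uw v metric_sharp[OF g V \<theta>(2) v] unfolding fibre_metric_def by metis
  finally show "g x (a *\<^sub>R ?u + b *\<^sub>R ?w) v = \<theta> v"
    using eq[OF v] by simp
qed

section \<open>The Jacobiator\<close>

lemma skew_on_subspace:
  assumes S: "subspace S"
    and r: "\<And>a. a \<in> S \<Longrightarrow> lin_on S (br a)" and l: "\<And>a. a \<in> S \<Longrightarrow> lin_on S (\<lambda>b. br b a)"
    and z: "\<And>a. a \<in> S \<Longrightarrow> br a a = 0" and ab: "a \<in> S" "b \<in> S"
  shows "br a b = - br b (a::'a::real_vector)"
proof -
  have ab': "a + b \<in> S" using S ab by (rule_tac subspace_add)
  have "0 = br (a + b) (a + b)" using z[OF ab'] by simp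
  also have "\<dots> = br a (a + b) + br b (a + b)"
    using l[OF ab'] ab unfolding lin_on_def by blast
  also have "br a (a + b) = br a a + br a b"
    using r[OF ab(1)] ab unfolding lin_on_def by blast
  also have "br b (a + b) = br b a + br b b"
    using r[OF ab(2)] ab unfolding lin_on_def by blast
  finally show ?thesis using z ab by (simp add: eq_neg_iff_add_eq_0)
qed

text \<open>
  This identity is an instance of \<open>[\<mu>, [\<mu>, \<mu>]] = 0\<close> for the Nijenhuis-Richardson bracket. Explicitly,
  every term of the form \<open>[x, [y, [z, w]]]\<close> occurs once in some \<open>[x, J(y, z, w)]\<close> and once, with
  the opposite sign, in some \<open>J([z, w], x, y)\<close>, and the terms \<open>[[x, y], [z, w]]\<close> cancel in pairs.
\<close>

lemma jacobiator_closed: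
  fixes br :: "'a::real_vector \<Rightarrow> 'a \<Rightarrow> 'a"
  defines "J \<equiv> \<lambda>x y z. br x (br y z) - br (br x y) z - br y (br x z)"
  assumes S: "subspace S"
    and cl: "\<And>x y. x \<in> S \<Longrightarrow> y \<in> S \<Longrightarrow> br x y \<in> S"
    and lin: "\<And>x. x \<in> S \<Longrightarrow> lin_on S (br x)"
    and sk: "\<And>x y. x \<in> S \<Longrightarrow> y \<in> S \<Longrightarrow> br x y = - br y x"
    and abcd: "a \<in> S" "b \<in> S" "c \<in> S" "d \<in> S"
  shows "br a (J b c d) - br b (J a c d) + br c (J a b d) - br d (J a b c)
    - J (br a b) c d + J (br a c) b d - J (br b c) a d
    - J (br a d) b c + J (br b d) a c - J (br c d) a b = 0"
proof -
  have add: "br x (y + z) = br x y + br x z" and diff: "br x (y - z) = br x y - br x z"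
    if "x \<in> S" "y \<in> S" "z \<in> S" for x y z
    using that lin_on_add[OF lin] lin_on_diff[OF lin S] by blast+
  have neg: "br x (- y) = - br x y" if "x \<in> S" "y \<in> S" for x y
    using lin_on_scaleR[OF lin[OF that(1)] that(2), of "- 1"] by simp
  have neg': "br (- y) x = - br y x" if "x \<in> S" "y \<in> S" for x y
    using sk[OF that(1) subspace_neg[OF S that(2)]] sk[OF that] neg[OF that] sk
      subspace_neg[OF S that(2)] that by metis
  \<comment> \<open>Skew-symmetry brings all terms into the form \<open>br x (br y (br z w))\<close> or \<open>br (br x y) (br z w)\<close>;
    the latter come in two orders, of which one is chosen in each of the three cases.\<close>
  have flip: "br (br x y) w = - br w (br x y)" if "w \<in> {a, b, c, d}" "x \<in> S" "y \<in> S" for w x y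
    using that abcd by (intro sk cl) auto
  have flip2: "br (br c d) (br a b) = - br (br a b) (br c d)"
    "br (br b d) (br a c) = - br (br a c) (br b d)"
    "br (br b c) (br a d) = - br (br a d) (br b c)"
    by (intro sk cl abcd)+
  show ?thesis
    unfolding J_def
    by (simp add: diff add subspace_add[OF S] neg neg' flip flip2 abcd cl subspace_diff[OF S] subspace_neg[OF S])
qed


section \<open>The twist restricted to a Dirac structure\<close>

lemma alternating_form_lin_on_last:
  assumes "alternating_form V (Suc p) \<alpha>" "set es \<subseteq> V" "length es = p" "subspace V"
  shows "lin_on V (\<lambda>e. \<alpha> (es @ [e]))"
  using alternating_form_lin_on_slot[OF assms(1), of es "[]" 0] assms by (auto intro: subspace_0)

text \<open>
  The condition on \<open>H\<close> concerns the vector obtained from the first slot, whereas the twist is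
  obtained from the last one. The two differ by the sign of a cyclic permutation.
\<close>

lemma anchor_induced_twist:
  assumes E: "vector_bundle M E" and g: "fibre_metric M E g" and ss: "split_signature E g"
    and H: "H \<in> kernel_forms M E g \<rho> (Suc p)" and \<rho>: "lin_on (fibre E x) (\<rho> x)"
    and \<psi>s: "length \<psi>s = p" "set \<psi>s \<subseteq> sections M E"
  shows "\<rho> x (induced_twist E g H \<psi>s x) = 0"
proof -
  let ?V = "fibre E x" and ?es = "map (\<lambda>\<psi>. \<psi> x) \<psi>s"
  let ?first = "\<lambda>e. H x (e # ?es)" and ?last = "\<lambda>e. H x (?es @ [e])"
  have V: "subspace ?V" using E by (rule vector_bundle_subspace)
  have Hx: "alternating_form ?V (Suc p) (H x)"
    using H unfolding kernel_forms_def wedge_sections_def by blast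
  have es: "set ?es \<subseteq> ?V" "length ?es = p"
    using \<psi>s by (auto intro: sections_in_fibre)
  have first: "lin_on ?V ?first"
    using alternating_form_lin_on_slot[OF Hx, of "[]" ?es 0] es subspace_0[OF V] by simp
  have last: "lin_on ?V ?last"
    by (rule alternating_form_lin_on_last[OF Hx es V])
  have "?last e = (- 1) ^ p * ?first e" if "e \<in> ?V" for e
    using alternating_form_rotate[OF Hx V, of "[]" ?es e] es that
    by (simp flip: mult.assoc power_add mult_2)
  then have "sharp E g x ?last = (- 1) ^ p *\<^sub>R sharp E g x ?first + 0 *\<^sub>R sharp E g x ?first"
    by (intro sharp_combination[OF g ss V first first]) simp
  then have "\<rho> x (sharp E g x ?last) = (- 1) ^ p *\<^sub>R \<rho> x (sharp E g x ?first)"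
    using lin_on_scaleR[OF \<rho> sharp_in_fibre[OF g ss V first]] by simp
  also have "\<rho> x (sharp E g x ?first) = 0"
    using H es unfolding kernel_forms_def rho_tilde_def by simp
  finally show ?thesis
    by (simp only: induced_twist_def scaleR_zero_right)
qed

text \<open>
  The form \<open>H\<close> and \<open>sharp\<close> act pointwise, so multilinearity over smooth functions and
  alternation are inherited from the fibres. That the values are sections of \<open>L\<close> cannot be seen
  pointwise and is an assumption here; on a Dirac structure it comes from the bracket.
\<close>

lemma induced_twist_kernel_valued:
  assumes E: "vector_bundle M E" and g: "fibre_metric M E g" and ss: "split_signature E g"
    and H: "H \<in> kernel_forms M E g \<rho> (Suc p)" and \<rho>: "\<And>x. lin_on (fibre E x) (\<rho> x)"
    and LE: "sections M L \<subseteq> sections M E"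
    and L: "\<And>\<psi>s. length \<psi>s = p \<Longrightarrow> set \<psi>s \<subseteq> sections M L \<Longrightarrow> induced_twist E g H \<psi>s \<in> sections M L"
  shows "induced_twist E g H \<in> kernel_valued_forms M L \<rho> p"
  unfolding kernel_valued_forms_def
proof (intro CollectI allI impI conjI ballI)
  let ?T = "induced_twist E g H"
  fix \<psi>s assume \<psi>s: "length \<psi>s = p \<and> set \<psi>s \<subseteq> sections M L"
  then have \<psi>sE: "length \<psi>s = p" "set \<psi>s \<subseteq> sections M E"
    using LE by auto
  have V: "subspace (fibre E x)" for x
    using E by (rule vector_bundle_subspace)
  have Hx: "alternating_form (fibre E x) (Suc p) (H x)" for x
    using H unfolding kernel_forms_def wedge_sections_def by blast
  let ?es = "\<lambda>x. map (\<lambda>\<psi>. \<psi> x) \<psi>s"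
  have es: "set (?es x) \<subseteq> fibre E x" "length (?es x) = p" for x
    using \<psi>sE by (auto intro: sections_in_fibre)
  have upd: "?T (\<psi>s[i := \<phi>]) x = sharp E g x (\<lambda>e. H x ((?es x @ [e])[i := \<phi> x]))"
    if "i < p" for i \<phi> x
    using that es unfolding induced_twist_def by (simp add: map_update list_update_append1)
  have slot: "lin_on (fibre E x) (\<lambda>a. H x ((?es x @ [e])[i := a]))"
    if "i < p" "e \<in> fibre E x" for i e x
  proof -
    have "length (?es x @ [e]) = Suc p \<and> set (?es x @ [e]) \<subseteq> fibre E x" "i < Suc p"
      using es that by auto
    then show ?thesis
      using Hx[of x] unfolding alternating_form_def by blast
  qed
  have last: "lin_on (fibre E x) (\<lambda>e. H x ((?es x @ [e])[i := a]))"
    if "i < p" "a \<in> fibre E x" for i a x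
  proof -
    have "lin_on (fibre E x) (\<lambda>e. H x ((?es x)[i := a] @ [e]))"
    proof (rule alternating_form_lin_on_last[OF Hx _ _ V])
      show "set ((?es x)[i := a]) \<subseteq> fibre E x"
        using set_update_subset_insert[of "?es x" i a] es(1)[of x] that(2) by blast
      show "length ((?es x)[i := a]) = p"
        using es(2) by simp
    qed
    then show ?thesis
      using es that by (simp add: list_update_append1)
  qed
  show "?T \<psi>s \<in> kernel_sections M L \<rho>"
    using L \<psi>s anchor_induced_twist[OF E g ss H \<rho> \<psi>sE] unfolding kernel_sections_def by simp
  {
    fix i \<phi> \<eta> assume i: "i < p" and "\<phi> \<in> sections M L" "\<eta> \<in> sections M L"
    then have "\<phi> \<in> sections M E" "\<eta> \<in> sections M E"
      using LE by blast+
    note mem = this[THEN sections_in_fibre]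
    show "?T (\<psi>s[i := \<phi> + \<eta>]) = ?T (\<psi>s[i := \<phi>]) + ?T (\<psi>s[i := \<eta>])"
    proof
      fix x
      have "sharp E g x (\<lambda>e. H x ((?es x @ [e])[i := (\<phi> + \<eta>) x]))
          = 1 *\<^sub>R sharp E g x (\<lambda>e. H x ((?es x @ [e])[i := \<phi> x]))
          + 1 *\<^sub>R sharp E g x (\<lambda>e. H x ((?es x @ [e])[i := \<eta> x]))"
        using lin_on_add[OF slot[OF i] mem]
        by (intro sharp_combination[OF g ss V last[OF i mem(1)] last[OF i mem(2)]]) simp
      then show "?T (\<psi>s[i := \<phi> + \<eta>]) x = (?T (\<psi>s[i := \<phi>]) + ?T (\<psi>s[i := \<eta>])) x"
        by (simp add: upd[OF i])
    qed
  next
    fix i \<phi> f assume i: "i < p" and "\<phi> \<in> sections M L"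
    then have "\<phi> \<in> sections M E"
      using LE by blast
    note mem = sections_in_fibre[OF this]
    show "?T (\<psi>s[i := fscale f \<phi>]) = fscale f (?T (\<psi>s[i := \<phi>]))"
    proof
      fix x
      \<comment> \<open>The second summand only serves to fit the shape of \<open>sharp_combination\<close>.\<close>
      have "sharp E g x (\<lambda>e. H x ((?es x @ [e])[i := fscale f \<phi> x]))
          = f x *\<^sub>R sharp E g x (\<lambda>e. H x ((?es x @ [e])[i := \<phi> x]))
          + 0 *\<^sub>R sharp E g x (\<lambda>e. H x ((?es x @ [e])[i := \<phi> x]))"
        using lin_on_scaleR[OF slot[OF i] mem]
        by (intro sharp_combination[OF g ss V last[OF i mem] last[OF i mem]]) (simp add: fscale_def)
      then show "?T (\<psi>s[i := fscale f \<phi>]) x = fscale f (?T (\<psi>s[i := \<phi>])) x"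
        by (simp add: upd[OF i] fscale_def)
    qed
  next
    fix i j assume ij: "i < j \<and> j < p \<and> \<psi>s ! i = \<psi>s ! j"
    show "?T \<psi>s = 0"
    proof
      fix x
      have "H x (?es x @ [e]) = 0" if "e \<in> fibre E x" for e
      proof -
        have "length (?es x @ [e]) = Suc p \<and> set (?es x @ [e]) \<subseteq> fibre E x"
          "i < j" "j < Suc p" "(?es x @ [e]) ! i = (?es x @ [e]) ! j"
          using es[of x] that ij \<psi>sE(1) by (auto simp: nth_append)
        then show ?thesis
          using Hx[of x] unfolding alternating_form_def by blast
      qed
      moreover have "g x 0 e = 0" if "e \<in> fibre E x" for e
      proof -
        have "g x 0 e = g x e 0" "lin_on (fibre E x) (g x e)"
          using g that subspace_0[OF V] unfolding fibre_metric_def by blast+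
        then show ?thesis
          using lin_on_zero[of "fibre E x" "g x e"] subspace_0[OF V, of x] by simp
      qed
      ultimately show "?T \<psi>s x = 0 x"
        unfolding induced_twist_def zero_fun_def
        by (intro sharp_eqI[OF g V subspace_0[OF V]]) simp
    qed
  }
qed

lemma subbundle_sections:
  assumes "smooth_manifold M" "vector_bundle M E" "subbundle M E L"
  shows "sections M L \<subseteq> sections M E"
  using assms bundle_map_sections[of M L E "\<lambda>x e. e"] unfolding subbundle_def by auto

text \<open>
  The symmetric part of the bracket is the differential of the function \<open>\<langle>\<psi>, \<psi>\<rangle>\<close>, which vanishes
  identically on an isotropic subbundle.
\<close>

lemma isotropic_bracket_self_zero:
  fixes M :: "'m::{t2_space,second_countable_topology} manifold"
  assumes M: "smooth_manifold M" and E: "twisted_courant_algebroid M E br g \<rho> H"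
    and L: "isotropic_subbundle M E g L" and \<psi>: "\<psi> \<in> sections M L"
  shows "br \<psi> \<psi> = 0"
proof -
  have vb: "vector_bundle M E" and g: "fibre_metric M E g" and br: "bracket_on M E br"
    and \<rho>: "bundle_map M E (tangent_bundle M) \<rho>"
    and ax4: "\<And>\<psi> \<eta>. \<psi> \<in> sections M E \<Longrightarrow> \<eta> \<in> sections M E \<Longrightarrow>
      pairing g (br \<psi> \<psi>) \<eta> = (1 / 2) *\<^sub>R courant_D \<rho> br (\<lambda>x _. pairing g \<psi> \<psi> x) [\<eta>]"
    using E unfolding twisted_courant_algebroid_def by simp_all
  have \<psi>E: "\<psi> \<in> sections M E"
    using subbundle_sections[OF M vb] L \<psi> unfolding isotropic_subbundle_def by blast
  have null: "pairing g \<psi> \<psi> x = 0" for x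
    using L sections_in_fibre[OF \<psi>, of x] unfolding isotropic_subbundle_def pairing_def by blast
  have "pairing g (br \<psi> \<psi>) \<eta> = 0" if \<eta>: "\<eta> \<in> sections M E" for \<eta>
  proof -
    have "\<rho> x (\<eta> x) (\<lambda>y. 0) = 0" for x
    proof -
      have v: "\<rho> x (\<eta> x) \<in> tangent_space M x"
        using bundle_map_in_fibre[OF \<rho> sections_in_fibre[OF \<eta>]] unfolding tangent_bundle_def by simp
      have 0: "0 \<in> smooth_functions M"
        unfolding smooth_functions_def zero_fun_def by (simp add: smooth_on_const)
      have "\<rho> x (\<eta> x) 0 = 0"
        using v unfolding tangent_space_def by (intro lin_on_zero[OF _ 0]) simp
      then show ?thesis by (simp add: zero_fun_def)
    qed
    then show ?thesis
      unfolding ax4[OF \<psi>E \<eta>]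
      by (simp add: courant_D_def null act_def form_eval_def omit_def fun_eq_iff scaleR_fun_def)
  qed
  moreover have "br \<psi> \<psi> \<in> sections M E"
    using br \<psi>E unfolding bracket_on_def by blast
  ultimately show ?thesis
    using fibre_metric_zeroI[OF M vb g] by blast
qed

text \<open>
  The components of a tangent vector are its values on fixed functions, hence linear in it.
\<close>

lemma tangent_bundle_triv_lin_on:
  assumes "smooth_manifold M" "(V, \<Psi>) \<in> trivs (tangent_bundle M)" "x \<in> V"
  shows "open V \<and> lin_on (fibre (tangent_bundle M) x) (\<Psi> x)"
proof -
  obtain \<phi> where "(V, \<phi>) \<in> atlas M" and \<Psi>: "\<Psi> = tangent_coord M V \<phi>"
    using assms(2) unfolding tangent_bundle_def by auto
  then have "open V"
    using chart_open[OF assms(1)] by blast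
  then show ?thesis
    unfolding \<Psi> lin_on_def tangent_coord_def by (simp add: fun_eq_iff scaleR_fun_def)
qed

text \<open>
  Evaluated on four sections, \<open>D\<close> of the Jacobiator is the alternating sum of
  \<open>jacobiator_closed\<close>.
\<close>

lemma jacobiator_D_closed:
  assumes S: "subspace (sections M A)" and br: "bracket_on M A br"
    and sk: "\<And>\<phi> \<psi>. \<phi> \<in> sections M A \<Longrightarrow> \<psi> \<in> sections M A \<Longrightarrow> br \<phi> \<psi> = - br \<psi> \<phi>"
    and J: "\<And>\<phi> \<psi>\<^sub>1 \<psi>\<^sub>2. \<phi> \<in> sections M A \<Longrightarrow> \<psi>\<^sub>1 \<in> sections M A \<Longrightarrow> \<psi>\<^sub>2 \<in> sections M A \<Longrightarrow>
      \<omega> [\<phi>, \<psi>\<^sub>1, \<psi>\<^sub>2] = br \<phi> (br \<psi>\<^sub>1 \<psi>\<^sub>2) - br (br \<phi> \<psi>\<^sub>1) \<psi>\<^sub>2 - br \<psi>\<^sub>1 (br \<phi> \<psi>\<^sub>2)"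
  shows "D_closed M A br 3 \<omega>"
  unfolding D_closed_def
proof (intro allI impI)
  fix \<psi>s assume \<psi>s: "length \<psi>s = Suc 3 \<and> set \<psi>s \<subseteq> sections M A"
  then obtain a b c d where abcd: "\<psi>s = [a, b, c, d]"
    by (auto simp: length_Suc_conv numeral_3_eq_3)
  then have mem: "a \<in> sections M A" "b \<in> sections M A" "c \<in> sections M A" "d \<in> sections M A"
    using \<psi>s by auto
  have cl: "br x y \<in> sections M A" and lin: "lin_on (sections M A) (br x)"
    if "x \<in> sections M A" "y \<in> sections M A" for x y
    using br that unfolding bracket_on_def by blast+
  have "lie_D br \<omega> \<psi>s = br a (\<omega> [b, c, d]) - br b (\<omega> [a, c, d]) + br c (\<omega> [a, b, d])
    - br d (\<omega> [a, b, c]) - \<omega> [br a b, c, d] + \<omega> [br a c, b, d] - \<omega> [br b c, a, d]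
    - \<omega> [br a d, b, c] + \<omega> [br b d, a, c] - \<omega> [br c d, a, b]"
    unfolding abcd lie_D_def by (simp add: omit_def lessThan_Suc numeral_eq_Suc algebra_simps)
  also have "\<dots> = 0"
    using jacobiator_closed[of "sections M A" br a b c d, OF S cl lin sk mem] mem
    by (simp only: J cl mem)
  finally show "lie_D br \<omega> \<psi>s = 0" .
qed

theorem proposition5p3:
  fixes M :: "'m::{t2_space,second_countable_topology} manifold"
    and E L :: "('m, 'v::real_vector) vbundle"
    and br :: "('m, 'v) bracket"
    and g :: "'m \<Rightarrow> 'v \<Rightarrow> 'v \<Rightarrow> real"
    and \<rho> :: "('m, 'v) anchor"
    and H :: "('m, 'v) form"
  assumes "smooth_manifold M"
    and "twisted_courant_algebroid M E br g \<rho> H"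
    and "split_signature E g"
    and "dirac_structure M E br g L"
  shows "twisted_lie_algebroid M L br \<rho> (induced_twist E g H) \<and>
    induced_twist E g H \<in> kernel_valued_forms M L \<rho> 3 \<and>
    D_closed M L br 3 (induced_twist E g H)"
proof -
  let ?S = "sections M L" and ?T = "induced_twist E g H"
  note M = assms(1) and ss = assms(3)
  have E: "vector_bundle M E" and g: "fibre_metric M E g" and br: "bracket_on M E br"
    and \<rho>: "bundle_map M E (tangent_bundle M) \<rho>" and H: "H \<in> kernel_forms M E g \<rho> (Suc 3)"
    and T: "\<And>\<phi> \<psi>\<^sub>1 \<psi>\<^sub>2. \<phi> \<in> sections M E \<Longrightarrow> \<psi>\<^sub>1 \<in> sections M E \<Longrightarrow> \<psi>\<^sub>2 \<in> sections M E \<Longrightarrow>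
      ?T [\<phi>, \<psi>\<^sub>1, \<psi>\<^sub>2] = br \<phi> (br \<psi>\<^sub>1 \<psi>\<^sub>2) - br (br \<phi> \<psi>\<^sub>1) \<psi>\<^sub>2 - br \<psi>\<^sub>1 (br \<phi> \<psi>\<^sub>2)"
    and leibniz: "\<And>\<phi> \<psi> f. \<phi> \<in> sections M E \<Longrightarrow> \<psi> \<in> sections M E \<Longrightarrow> f \<in> smooth_functions M \<Longrightarrow>
      br \<phi> (fscale f \<psi>) = fscale (act \<rho> \<phi> f) \<psi> + fscale f (br \<phi> \<psi>)"
    using assms(2) unfolding twisted_courant_algebroid_def by simp_all
  have iso: "isotropic_subbundle M E g L"
    and cl: "\<And>\<phi> \<psi>. \<phi> \<in> ?S \<Longrightarrow> \<psi> \<in> ?S \<Longrightarrow> br \<phi> \<psi> \<in> ?S"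
    using assms(4) unfolding dirac_structure_def integrable_subbundle_def by blast+
  then have sub: "subbundle M E L" and L: "vector_bundle M L" and incl: "bundle_map M L E (\<lambda>x e. e)"
    unfolding isotropic_subbundle_def subbundle_def by blast+
  have LE: "?S \<subseteq> sections M E"
    by (rule subbundle_sections[OF M E sub])
  have S: "subspace ?S"
    by (rule subspace_sections[OF M L])
  have brL: "bracket_on M L br"
    unfolding bracket_on_def
  proof (intro ballI conjI)
    fix \<phi> assume \<phi>: "\<phi> \<in> ?S"
    then have "\<phi> \<in> sections M E" using LE by blast
    then have "lin_on (sections M E) (br \<phi>)" "lin_on (sections M E) (\<lambda>\<psi>. br \<psi> \<phi>)"
      using br unfolding bracket_on_def by simp_all
    then show "lin_on ?S (br \<phi>)" "lin_on ?S (\<lambda>\<psi>. br \<psi> \<phi>)"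
      by (auto intro: lin_on_subset[OF _ LE])
    show "br \<phi> \<psi> \<in> ?S" if "\<psi> \<in> ?S" for \<psi>
      using cl \<phi> that .
  qed
  have skew: "br \<phi> \<psi> = - br \<psi> \<phi>" if "\<phi> \<in> ?S" "\<psi> \<in> ?S" for \<phi> \<psi>
  proof (rule skew_on_subspace[OF S _ _ _ that])
    fix \<phi> assume "\<phi> \<in> ?S"
    then show "lin_on ?S (br \<phi>)" "lin_on ?S (\<lambda>\<psi>. br \<psi> \<phi>)" "br \<phi> \<phi> = 0"
      using brL isotropic_bracket_self_zero[OF M assms(2) iso] unfolding bracket_on_def by simp_all
  qed
  have J: "?T [\<phi>, \<psi>\<^sub>1, \<psi>\<^sub>2] = br \<phi> (br \<psi>\<^sub>1 \<psi>\<^sub>2) - br (br \<phi> \<psi>\<^sub>1) \<psi>\<^sub>2 - br \<psi>\<^sub>1 (br \<phi> \<psi>\<^sub>2)"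
    if "\<phi> \<in> ?S" "\<psi>\<^sub>1 \<in> ?S" "\<psi>\<^sub>2 \<in> ?S" for \<phi> \<psi>\<^sub>1 \<psi>\<^sub>2
    using T LE that by blast
  have closed: "D_closed M L br 3 ?T"
    by (rule jacobiator_D_closed[OF S brL skew J])
  have form: "?T \<in> kernel_valued_forms M L \<rho> 3"
  proof (rule induced_twist_kernel_valued[OF E g ss H bundle_map_lin_on[OF \<rho>] LE])
    fix \<psi>s :: "('m \<Rightarrow> 'v) list" assume "length \<psi>s = 3" "set \<psi>s \<subseteq> ?S"
    then obtain a b c where "\<psi>s = [a, b, c]" "a \<in> ?S" "b \<in> ?S" "c \<in> ?S"
      by (auto simp: length_Suc_conv numeral_3_eq_3)
    then show "?T \<psi>s \<in> ?S"
      by (simp add: J cl subspace_diff[OF S])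
  qed
  have "twisted_lie_algebroid M L br \<rho> ?T"
    unfolding twisted_lie_algebroid_def
  proof (intro conjI ballI)
    show "bundle_map M L (tangent_bundle M) \<rho>"
      by (rule bundle_map_comp[OF M L E incl \<rho>]) (rule tangent_bundle_triv_lin_on[OF M])
    show "br \<phi> \<psi> = - br \<psi> \<phi>" if "\<phi> \<in> ?S" "\<psi> \<in> ?S" for \<phi> \<psi>
      using that by (rule skew)
    show "br \<phi> (br \<psi>\<^sub>1 \<psi>\<^sub>2) = br (br \<phi> \<psi>\<^sub>1) \<psi>\<^sub>2 + br \<psi>\<^sub>1 (br \<phi> \<psi>\<^sub>2) + ?T [\<phi>, \<psi>\<^sub>1, \<psi>\<^sub>2]"
      if "\<phi> \<in> ?S" "\<psi>\<^sub>1 \<in> ?S" "\<psi>\<^sub>2 \<in> ?S" for \<phi> \<psi>\<^sub>1 \<psi>\<^sub>2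
      by (simp add: J[OF that])
    show "br \<phi> (fscale f \<psi>) = fscale (act \<rho> \<phi> f) \<psi> + fscale f (br \<phi> \<psi>)"
      if "\<phi> \<in> ?S" "\<psi> \<in> ?S" "f \<in> smooth_functions M" for \<phi> \<psi> f
      using leibniz LE that by blast
  qed (fact L form brL closed)+
  with form closed show ?thesis by blast
qed

end
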